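(* Let $\mathcal{A}$ be a unital $C^*$-algebra, $\alpha$ an endomorphism of $\mathcal{A}$, $\mu$ a state on $\mathcal{A}$, and $m_0\in\mathcal{A}$ such that $$\mu(m_0^*\,\alpha(f)\,m_0)=\mu(f)\qquad\text{for all } f\in\mathcal{A}.$$ Then there exist a Hilbert space $H$, a representation $\pi$ of $\mathcal{A}$ on $H$, a unitary operator $U$ on $H$, and a vector $\varphi\in H$ with the following properties: $$U\pi(f)U^*=\pi(\alpha(f)),\qquad f\in\mathcal{A},$$ $$\langle \varphi\mid\pi(f)\varphi\rangle=\mu(f),\qquad f\in\mathcal{A},$$ $$U\varphi=\pi(\alpha(1)m_0)\varphi,$$ $$\overline{\operatorname{span}}\{\,U^{-n}\pi(f)\varphi\mid n\geq 0,\ f\in\mathcal{A}\,\}=H.$$ Moreover, $(H,U,\pi,\varphi)$ is unique up to an intertwining isomorphism: if $(H',U',\pi',\varphi')$ is another quadruple with these properties, there is a unitary $W\colon H\to H'$ with $WU=U'W$, $W\pi(f)=\pi'(f)W$ for all $f\in\mathcal{A}$, and $W\varphi=\varphi'$.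
   Context: An endomorphism of a $C^*$-algebra is a $*$-homomorphism $\alpha\colon\mathcal{A}\to\mathcal{A}$ (not assumed unital). A representation is a $*$-homomorphism into the bounded operators on a Hilbert space (not assumed nondegenerate). Inner products $\langle\cdot\mid\cdot\rangle$ are linear in the second variable. *)

theory Defs
  imports "HOL-Analysis.Analysis" "HOL-Library.Function_Algebras" "HOL-Library.Nonpos_Ints"
begin

section \<open>Complex vector spaces and unital C*-algebras\<close>

class complex_vector = ab_group_add +
  fixes scaleC :: "complex \<Rightarrow> 'a \<Rightarrow> 'a"  (infixr \<open>*\<^sub>C\<close> 75)
  assumes scaleC_add_right: "a *\<^sub>C (x + y) = a *\<^sub>C x + a *\<^sub>C y"
    and scaleC_add_left: "(a + b) *\<^sub>C x = a *\<^sub>C x + b *\<^sub>C x"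
    and scaleC_scaleC: "a *\<^sub>C (b *\<^sub>C x) = (a * b) *\<^sub>C x"
    and scaleC_one: "1 *\<^sub>C x = x"

global_interpretation complex_vector: vector_space "scaleC :: complex \<Rightarrow> 'a \<Rightarrow> 'a::complex_vector"
  by unfold_locales (simp_all add: scaleC_add_right scaleC_add_left scaleC_scaleC scaleC_one)

text \<open>
  The ancestor \<^class>\<open>real_normed_algebra_1\<close> requires \<open>norm 1 = 1\<close>, which for a C*-algebra only
  excludes the zero algebra; that algebra carries no state.
\<close>

class unital_cstar_algebra = complex_vector + real_normed_algebra_1 + complete_space +
  fixes star :: "'a \<Rightarrow> 'a"
  assumes scaleR_eq_scaleC: "r *\<^sub>R x = complex_of_real r *\<^sub>C x"
    and norm_scaleC: "norm (c *\<^sub>C x) = cmod c * norm x"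
    and mult_scaleC_left: "(c *\<^sub>C x) * y = c *\<^sub>C (x * y)"
    and mult_scaleC_right: "x * (c *\<^sub>C y) = c *\<^sub>C (x * y)"
    and star_star: "star (star x) = x"
    and star_add: "star (x + y) = star x + star y"
    and star_scaleC: "star (c *\<^sub>C x) = cnj c *\<^sub>C star x"
    and star_mult: "star (x * y) = star y * star x"
    and cstar_identity: "norm (star x * x) = (norm x)\<^sup>2"

instantiation complex :: unital_cstar_algebra
begin
definition scaleC_complex :: "complex \<Rightarrow> complex \<Rightarrow> complex"
  where "scaleC_complex c x = c * x"
definition star_complex :: "complex \<Rightarrow> complex"
  where "star_complex = cnj"
instance
  by standard
    (simp_all add: scaleC_complex_def star_complex_def algebra_simps norm_mult
      scaleR_conv_of_real power2_eq_square)
end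

instantiation "fun" :: (type, complex_vector) complex_vector
begin
definition scaleC_fun :: "complex \<Rightarrow> ('a \<Rightarrow> 'b) \<Rightarrow> 'a \<Rightarrow> 'b"
  where "scaleC_fun c f = (\<lambda>x. c *\<^sub>C f x)"
instance
  by standard
    (simp_all add: scaleC_fun_def fun_eq_iff scaleC_add_right scaleC_add_left
      scaleC_scaleC scaleC_one)
end

definition star_hom :: "('a::unital_cstar_algebra \<Rightarrow> 'b::unital_cstar_algebra) \<Rightarrow> bool" where
  "star_hom \<alpha> \<longleftrightarrow>
     (\<forall>f g. \<alpha> (f + g) = \<alpha> f + \<alpha> g) \<and>
     (\<forall>c f. \<alpha> (c *\<^sub>C f) = c *\<^sub>C \<alpha> f) \<and>
     (\<forall>f g. \<alpha> (f * g) = \<alpha> f * \<alpha> g) \<and>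
     (\<forall>f. \<alpha> (star f) = star (\<alpha> f))"

definition cstar_state :: "('a::unital_cstar_algebra \<Rightarrow> complex) \<Rightarrow> bool" where
  "cstar_state \<mu> \<longleftrightarrow>
     (\<forall>f g. \<mu> (f + g) = \<mu> f + \<mu> g) \<and>
     (\<forall>c f. \<mu> (c *\<^sub>C f) = c * \<mu> f) \<and>
     (\<forall>f. \<mu> (star f * f) \<in> \<real>\<^sub>\<ge>\<^sub>0) \<and>
     \<mu> 1 = 1"

section \<open>Hilbert spaces and their operators\<close>

text \<open>
  Types cannot be quantified existentially, so a Hilbert space is a linear subspace of an ambient
  complex vector space together with an inner product of its own; the vector space structure is
  inherited from the ambient type, the topology comes from the inner product alone. Operators are
  functions on the ambient types of which only the values on the carriers are meaningful.
\<close>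

record 'h hspace =
  hcarrier :: "'h set"
  hinner :: "'h \<Rightarrow> 'h \<Rightarrow> complex"

definition hnorm :: "'h hspace \<Rightarrow> 'h \<Rightarrow> real" where
  "hnorm X x = sqrt (Re (hinner X x x))"

text \<open>
  The value \<open>0\<close> off the carrier is needed because \<^locale>\<open>Metric_space\<close> demands nonnegativity and
  symmetry on the whole type.
\<close>

definition hdist :: "'h::complex_vector hspace \<Rightarrow> 'h \<Rightarrow> 'h \<Rightarrow> real" where
  "hdist X x y =
     (if x \<in> hcarrier X \<and> y \<in> hcarrier X then hnorm X (x - y) else 0)"

definition hilbert_space :: "'h::complex_vector hspace \<Rightarrow> bool" where
  "hilbert_space X \<longleftrightarrow>
     complex_vector.subspace (hcarrier X) \<and>
     (\<forall>x\<in>hcarrier X. \<forall>y\<in>hcarrier X. \<forall>z\<in>hcarrier X.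
        hinner X x (y + z) = hinner X x y + hinner X x z) \<and>
     (\<forall>c. \<forall>x\<in>hcarrier X. \<forall>y\<in>hcarrier X. hinner X x (c *\<^sub>C y) = c * hinner X x y) \<and>
     (\<forall>x\<in>hcarrier X. \<forall>y\<in>hcarrier X. hinner X y x = cnj (hinner X x y)) \<and>
     (\<forall>x\<in>hcarrier X. hinner X x x \<in> \<real>\<^sub>\<ge>\<^sub>0) \<and>
     (\<forall>x\<in>hcarrier X. hinner X x x = 0 \<longrightarrow> x = 0) \<and>
     Metric_space.mcomplete (hcarrier X) (hdist X)"

definition htopology :: "'h::complex_vector hspace \<Rightarrow> 'h topology" where
  "htopology X = Metric_space.mtopology (hcarrier X) (hdist X)"

definition bounded_op ::
  "'h::complex_vector hspace \<Rightarrow> 'k::complex_vector hspace \<Rightarrow> ('h \<Rightarrow> 'k) \<Rightarrow> bool" where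
  "bounded_op X Y T \<longleftrightarrow>
     T \<in> hcarrier X \<rightarrow> hcarrier Y \<and>
     (\<forall>x\<in>hcarrier X. \<forall>y\<in>hcarrier X. T (x + y) = T x + T y) \<and>
     (\<forall>c. \<forall>x\<in>hcarrier X. T (c *\<^sub>C x) = c *\<^sub>C T x) \<and>
     (\<exists>K. \<forall>x\<in>hcarrier X. hnorm Y (T x) \<le> K * hnorm X x)"

text \<open>For Hilbert spaces and bounded \<open>T\<close> the description below is proper, by Riesz.\<close>

definition hadjoint :: "'h hspace \<Rightarrow> 'k hspace \<Rightarrow> ('h \<Rightarrow> 'k) \<Rightarrow> 'k \<Rightarrow> 'h" where
  "hadjoint X Y T y =
     (THE z. z \<in> hcarrier X \<and> (\<forall>x\<in>hcarrier X. hinner Y (T x) y = hinner X x z))"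

definition unitary_op ::
  "'h::complex_vector hspace \<Rightarrow> 'k::complex_vector hspace \<Rightarrow> ('h \<Rightarrow> 'k) \<Rightarrow> bool" where
  "unitary_op X Y U \<longleftrightarrow>
     bounded_op X Y U \<and>
     (\<forall>x\<in>hcarrier X. hadjoint X Y U (U x) = x) \<and>
     (\<forall>y\<in>hcarrier Y. U (hadjoint X Y U y) = y)"

definition representation ::
  "'h::complex_vector hspace \<Rightarrow> ('a::unital_cstar_algebra \<Rightarrow> 'h \<Rightarrow> 'h) \<Rightarrow> bool" where
  "representation X \<pi> \<longleftrightarrow>
     (\<forall>f. bounded_op X X (\<pi> f)) \<and>
     (\<forall>f g. \<forall>x\<in>hcarrier X. \<pi> (f + g) x = \<pi> f x + \<pi> g x) \<and>
     (\<forall>c f. \<forall>x\<in>hcarrier X. \<pi> (c *\<^sub>C f) x = c *\<^sub>C \<pi> f x) \<and>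
     (\<forall>f g. \<forall>x\<in>hcarrier X. \<pi> (f * g) x = \<pi> f (\<pi> g x)) \<and>
     (\<forall>f. \<forall>x\<in>hcarrier X. \<pi> (star f) x = hadjoint X X (\<pi> f) x)"

section \<open>Covariant quadruples\<close>

text \<open>\<open>inv_into (hcarrier X) U ^^ n\<close> is the operator \<open>U\<close> to the power \<open>-n\<close>.\<close>

definition covariant_quadruple ::
  "('a::unital_cstar_algebra \<Rightarrow> 'a) \<Rightarrow> ('a \<Rightarrow> complex) \<Rightarrow> 'a \<Rightarrow>
   'h::complex_vector hspace \<Rightarrow> ('h \<Rightarrow> 'h) \<Rightarrow> ('a \<Rightarrow> 'h \<Rightarrow> 'h) \<Rightarrow> 'h \<Rightarrow> bool" where
  "covariant_quadruple \<alpha> \<mu> m\<^sub>0 X U \<pi> \<phi> \<longleftrightarrow>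
     hilbert_space X \<and> representation X \<pi> \<and> unitary_op X X U \<and> \<phi> \<in> hcarrier X \<and>
     (\<forall>f. \<forall>x\<in>hcarrier X. U (\<pi> f (hadjoint X X U x)) = \<pi> (\<alpha> f) x) \<and>
     (\<forall>f. hinner X \<phi> (\<pi> f \<phi>) = \<mu> f) \<and>
     U \<phi> = \<pi> (\<alpha> 1 * m\<^sub>0) \<phi> \<and>
     htopology X closure_of
       complex_vector.span {(inv_into (hcarrier X) U ^^ n) (\<pi> f \<phi>) | n f. True} = hcarrier X"

end

theory Submission
  imports Defs
begin

text \<open>
  Put \<open>V f = \<alpha> f * m\<^sub>0\<close>. In every quadruple \<open>U \<pi>(f) \<phi> = \<pi>(V f) \<phi>\<close>, so the Gram matrix of the total family
  \<open>U\<^sup>-\<^sup>n \<pi>(f) \<phi>\<close> depends only on \<open>\<alpha>\<close>, \<open>\<mu>\<close> and \<open>m\<^sub>0\<close>; this gives uniqueness. For existence this Gram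
  matrix is taken as a positive definite kernel on the set of pairs \<open>(n, f)\<close>. Its reproducing kernel
  Hilbert space consists of functions \<open>\<xi>\<close> on that set with \<open>\<xi>(n, f) = \<langle>U\<^sup>-\<^sup>n \<pi>(f) \<phi> | \<xi>\<rangle>\<close>, so the
  operators are forced to be compositions: \<open>(U \<xi>)(n, f) = \<xi>(n + 1, f)\<close> and
  \<open>(\<pi>(g) \<xi>)(n, f) = \<xi>(n, \<alpha>\<^sup>n(g\<^sup>*) f)\<close>.
\<close>

section \<open>Inner product spaces\<close>

text \<open>Positivity of a kernel concerns all finite linear combinations, and a completion must
  live in a type fixed beforehand. One observation settles both: \<open>U^-n \<pi>(f) \<phi>\<close>
  equals \<open>U^-(n+m) \<pi>(V^m f) \<phi>\<close>, so any two vectors of the family can be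
  written at a common level, and the family is already a linear space. Positivity is then only
  \<open>\<mu> (star f * f) \<ge> 0\<close>, and the completion consists of pointwise limits of the
  kernel sections. That the kernel respects this change of level is the hypothesis on
  \<open>m\<^sub>0\<close> in disguise: \<open>V\<close> preserves the form
  \<open>\<mu> (star f * g)\<close>. The analytic obstacle is the boundedness of
  \<open>\<pi>(g)\<close>. At level n it multiplies by \<open>\<alpha>^n(g)\<close>, so a bound
  independent of n is required. It comes from writing \<open>1 - star h * h\<close>, for h of norm
  less than 1, as the square of a selfadjoint element, the square root being a binomial series;
  every power of \<alpha> carries this identity along with the same constants.\<close>

lemma null_comparison:
  assumes "g \<longlonglongrightarrow> (0::real)" "\<And>j. norm (f j) \<le> g j"
  shows "f \<longlonglongrightarrow> (0::'a::real_normed_vector)"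
  by (rule Lim_null_comparison[OF _ assms(1)]) (simp add: assms(2))

text \<open>Definiteness is kept out because for the space of kernel sections it is deduced from the
  Cauchy-Schwarz inequality, which must therefore be available beforehand.\<close>

locale semi_inner_space =
  fixes X :: "'h::complex_vector hspace"
  assumes subspace: "complex_vector.subspace (hcarrier X)"
    and inner_add_right: "\<lbrakk>x \<in> hcarrier X; y \<in> hcarrier X; z \<in> hcarrier X\<rbrakk> \<Longrightarrow>
          hinner X x (y + z) = hinner X x y + hinner X x z"
    and inner_scaleC_right: "\<lbrakk>x \<in> hcarrier X; y \<in> hcarrier X\<rbrakk> \<Longrightarrow>
          hinner X x (c *\<^sub>C y) = c * hinner X x y"
    and inner_commute: "\<lbrakk>x \<in> hcarrier X; y \<in> hcarrier X\<rbrakk> \<Longrightarrow>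
          hinner X y x = cnj (hinner X x y)"
    and inner_nonneg: "x \<in> hcarrier X \<Longrightarrow> hinner X x x \<in> \<real>\<^sub>\<ge>\<^sub>0"
begin

abbreviation "H \<equiv> hcarrier X"
abbreviation "ip \<equiv> hinner X"
abbreviation "nrm \<equiv> hnorm X"

lemma mem [simp, intro]:
  "0 \<in> H" "x \<in> H \<Longrightarrow> y \<in> H \<Longrightarrow> x + y \<in> H" "x \<in> H \<Longrightarrow> c *\<^sub>C x \<in> H"
  "x \<in> H \<Longrightarrow> y \<in> H \<Longrightarrow> x - y \<in> H"
  using subspace
  by (auto intro: complex_vector.subspace_0 complex_vector.subspace_add
      complex_vector.subspace_scale complex_vector.subspace_diff)

lemma diff_conv: "(x::'b::complex_vector) - y = x + (-1) *\<^sub>C y"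
  by simp

lemma inner_diff_right: "x \<in> H \<Longrightarrow> y \<in> H \<Longrightarrow> z \<in> H \<Longrightarrow> ip x (y - z) = ip x y - ip x z"
  unfolding diff_conv by (subst inner_add_right) (use inner_scaleC_right[of x z "-1"] mem(3)[of z "-1"] in auto)

lemma inner_add_left: "x \<in> H \<Longrightarrow> y \<in> H \<Longrightarrow> z \<in> H \<Longrightarrow> ip (x + y) z = ip x z + ip y z"
  by (metis (no_types, lifting) complex_cnj_add inner_add_right inner_commute mem(2))

lemma inner_scaleC_left: "x \<in> H \<Longrightarrow> y \<in> H \<Longrightarrow> ip (c *\<^sub>C x) y = cnj c * ip x y"
  by (metis (no_types, lifting) complex_cnj_mult inner_commute inner_scaleC_right mem(3))

lemma inner_diff_left: "x \<in> H \<Longrightarrow> y \<in> H \<Longrightarrow> z \<in> H \<Longrightarrow> ip (x - y) z = ip x z - ip y z"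
  by (metis (no_types, lifting) complex_cnj_diff inner_commute inner_diff_right mem(4))

lemmas inner_simps = inner_add_right inner_scaleC_right inner_diff_right
  inner_add_left inner_scaleC_left inner_diff_left

lemma inner_zero [simp]: "x \<in> H \<Longrightarrow> ip x 0 = 0" "x \<in> H \<Longrightarrow> ip 0 x = 0"
  using inner_diff_right[of x x x] inner_diff_left[of x x x] by auto

lemma inner_self_Re_nonneg: "x \<in> H \<Longrightarrow> 0 \<le> Re (ip x x)"
  using inner_nonneg[of x] by (simp add: complex_nonneg_Reals_iff)

lemma nrm_nonneg [simp]: "x \<in> H \<Longrightarrow> 0 \<le> nrm x"
  by (simp add: hnorm_def inner_self_Re_nonneg)

lemma nrm_square: "x \<in> H \<Longrightarrow> (nrm x)\<^sup>2 = Re (ip x x)"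
  by (simp add: hnorm_def inner_self_Re_nonneg)

lemma inner_self: "x \<in> H \<Longrightarrow> ip x x = complex_of_real ((nrm x)\<^sup>2)"
  using inner_nonneg[of x] by (simp add: nrm_square complex_nonneg_Reals_iff complex_eq_iff)

lemma inner_commute_Re: "x \<in> H \<Longrightarrow> y \<in> H \<Longrightarrow> Re (ip y x) = Re (ip x y)"
  by (simp add: inner_commute[of x y])

lemma nrm_zero [simp]: "nrm 0 = 0"
  by (simp add: hnorm_def)

lemma nrm_scaleC: assumes "x \<in> H" shows "nrm (c *\<^sub>C x) = cmod c * nrm x"
proof -
  have "ip (c *\<^sub>C x) (c *\<^sub>C x) = (c * cnj c) * ip x x"
    using assms by (simp add: inner_simps)
  also have "\<dots> = complex_of_real ((cmod c)\<^sup>2 * (nrm x)\<^sup>2)"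
    unfolding inner_self[OF assms] complex_norm_square[symmetric] by simp
  finally have "(nrm (c *\<^sub>C x))\<^sup>2 = (cmod c * nrm x)\<^sup>2"
    using assms by (simp add: nrm_square power_mult_distrib)
  then show ?thesis using assms by (simp add: power2_eq_iff_nonneg)
qed

lemma nrm_minus_commute: "x \<in> H \<Longrightarrow> y \<in> H \<Longrightarrow> nrm (x - y) = nrm (y - x)"
  using nrm_scaleC[of "y - x" "-1"] by simp

lemma nrm_diff_square:
  assumes "x \<in> H" "y \<in> H"
  shows "(nrm (x - y))\<^sup>2 = (nrm x)\<^sup>2 - 2 * Re (ip x y) + (nrm y)\<^sup>2"
  using assms inner_commute_Re[of x y] by (simp add: nrm_square inner_simps)

lemma nrm_add_square:
  assumes "x \<in> H" "y \<in> H"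
  shows "(nrm (x + y))\<^sup>2 = (nrm x)\<^sup>2 + 2 * Re (ip x y) + (nrm y)\<^sup>2"
  using assms inner_commute_Re[of x y] by (simp add: nrm_square inner_simps)

lemma parallelogram:
  assumes "x \<in> H" "y \<in> H"
  shows "(nrm (x - y))\<^sup>2 = 2 * (nrm x)\<^sup>2 + 2 * (nrm y)\<^sup>2 - (nrm (x + y))\<^sup>2"
  using assms by (simp add: nrm_diff_square nrm_add_square)

lemma cauchy_schwarz:
  assumes x: "x \<in> H" and y: "y \<in> H"
  shows "cmod (ip x y) \<le> nrm x * nrm y"
proof -
  define A B C where "A = (nrm x)\<^sup>2" and "B = (cmod (ip x y))\<^sup>2" and "C = (nrm y)\<^sup>2"
  have nn: "0 \<le> A" "0 \<le> B" "0 \<le> C" by (auto simp: A_def B_def C_def)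
  have ineq: "0 \<le> A - 2 * t * B + t\<^sup>2 * B * C" for t :: real
  proof -
    \<comment> \<open>This multiplier cancels the phase of \<open>ip x y\<close>, so the expanded
      square is a real quadratic in \<open>t\<close>.\<close>
    define c where "c = of_real t * cnj (ip x y)"
    have "0 \<le> (nrm (x - c *\<^sub>C y))\<^sup>2" by simp
    also have "\<dots> = A - 2 * Re (ip x (c *\<^sub>C y)) + (nrm (c *\<^sub>C y))\<^sup>2"
      using x y by (simp add: nrm_diff_square A_def)
    also have "ip x (c *\<^sub>C y) = of_real (t * B)"
      using x y unfolding B_def of_real_mult complex_norm_square
      by (simp add: inner_scaleC_right c_def mult.commute mult.left_commute)
    also have "(nrm (c *\<^sub>C y))\<^sup>2 = t\<^sup>2 * B * C"
      using y by (simp add: nrm_scaleC c_def norm_mult power_mult_distrib B_def C_def)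
    finally show ?thesis by simp
  qed
  have "B \<le> A * C"
  proof (cases "C = 0")
    case True
    have "B = 0"
    proof (rule ccontr)
      assume "B \<noteq> 0"
      \<comment> \<open>With \<open>C = 0\<close> the inequality is affine in \<open>t\<close>; at
        this \<open>t\<close> it reads \<open>0 \<le> -1\<close>.\<close>
      then have "2 * ((A + 1) / (2 * B)) * B = A + 1" by simp
      with ineq[of "(A + 1) / (2 * B)"] True nn show False by simp
    qed
    then show ?thesis using nn by simp
  next
    case False
    have "(1 / C)\<^sup>2 * B * C = B / C" by (simp add: power2_eq_square)
    with ineq[of "1 / C"] have "B / C \<le> A" by simp
    then show ?thesis using False nn by (simp add: pos_divide_le_eq)
  qed
  then have "(cmod (ip x y))\<^sup>2 \<le> (nrm x * nrm y)\<^sup>2"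
    by (simp add: A_def B_def C_def power_mult_distrib)
  then show ?thesis by (rule power2_le_imp_le) (intro add_nonneg_nonneg mult_nonneg_nonneg nrm_nonneg x y)+
qed

lemma triangle:
  assumes x: "x \<in> H" and y: "y \<in> H"
  shows "nrm (x + y) \<le> nrm x + nrm y"
proof -
  have "Re (ip x y) \<le> nrm x * nrm y"
    using cauchy_schwarz[OF x y] complex_Re_le_cmod order_trans by blast
  then have "(nrm (x + y))\<^sup>2 \<le> (nrm x + nrm y)\<^sup>2"
    unfolding nrm_add_square[OF x y] power2_sum by linarith
  then show ?thesis by (rule power2_le_imp_le) (intro add_nonneg_nonneg mult_nonneg_nonneg nrm_nonneg x y)+
qed

lemma triangle_diff:
  assumes "x \<in> H" "y \<in> H" "z \<in> H"
  shows "nrm (x - z) \<le> nrm (x - y) + nrm (y - z)"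
  using triangle[of "x - y" "y - z"] assms by simp

lemma triangle_reverse:
  assumes "x \<in> H" "y \<in> H"
  shows "\<bar>nrm x - nrm y\<bar> \<le> nrm (x - y)"
  using triangle[of "x - y" y] triangle[of "y - x" x] assms nrm_minus_commute[of x y]
  by simp

end

locale inner_space = semi_inner_space +
  assumes inner_eq_zeroD: "x \<in> hcarrier X \<Longrightarrow> hinner X x x = 0 \<Longrightarrow> x = 0"
begin

lemma nrm_eq_zero: "x \<in> H \<Longrightarrow> nrm x = 0 \<longleftrightarrow> x = 0"
  using inner_eq_zeroD inner_self by force

lemma eqI_inner:
  assumes "x \<in> H" "y \<in> H" "\<And>z. z \<in> H \<Longrightarrow> ip z x = ip z y"
  shows "x = y"
  using inner_eq_zeroD[of "x - y"] assms by (simp add: inner_simps)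

lemma metric: "Metric_space H (hdist X)"
proof
  show "0 \<le> hdist X x y" for x y by (simp add: hdist_def)
  show "hdist X x y = hdist X y x" for x y
    by (simp add: hdist_def nrm_minus_commute)
  show "hdist X x y = 0 \<longleftrightarrow> x = y" if "x \<in> H" "y \<in> H" for x y
    using that by (simp add: hdist_def nrm_eq_zero)
  show "hdist X x z \<le> hdist X x y + hdist X y z" if "x \<in> H" "y \<in> H" "z \<in> H" for x y z
    using that by (simp add: hdist_def triangle_diff)
qed

end

text \<open>Norm versions of the metric notions. Since \<open>hdist\<close> is 0 off the carrier and
  carries no information there, membership of the terms is stated separately.\<close>

definition hcauchy :: "'h::complex_vector hspace \<Rightarrow> (nat \<Rightarrow> 'h) \<Rightarrow> bool" where
  "hcauchy X a \<longleftrightarrow> range a \<subseteq> hcarrier X \<and>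
     (\<forall>e>0. \<exists>N. \<forall>i j. N \<le> i \<longrightarrow> N \<le> j \<longrightarrow> hnorm X (a i - a j) < e)"

definition hconv :: "'h::complex_vector hspace \<Rightarrow> (nat \<Rightarrow> 'h) \<Rightarrow> 'h \<Rightarrow> bool" where
  "hconv X a x \<longleftrightarrow> range a \<subseteq> hcarrier X \<and> x \<in> hcarrier X \<and> (\<lambda>j. hnorm X (a j - x)) \<longlonglongrightarrow> 0"

context inner_space
begin

lemma MCauchy_iff: "Metric_space.MCauchy H (hdist X) a \<longleftrightarrow> hcauchy X a"
proof -
  interpret M: Metric_space H "hdist X" by (rule metric)
  show ?thesis
    unfolding M.MCauchy_def hcauchy_def
    by (auto simp: hdist_def range_subsetD)
qed

lemma limitin_iff: "range a \<subseteq> H \<Longrightarrow> limitin (htopology X) a x sequentially \<longleftrightarrow> hconv X a x"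
proof -
  assume a: "range a \<subseteq> H"
  interpret M: Metric_space H "hdist X" by (rule metric)
  have "a j \<in> H" for j using a by auto
  then show ?thesis
    unfolding htopology_def hconv_def M.limitin_metric_dist_null
    by (auto simp: hdist_def)
qed

lemma hilbert_space_iff:
  "hilbert_space X \<longleftrightarrow> (\<forall>a. hcauchy X a \<longrightarrow> (\<exists>x. hconv X a x))"
proof -
  interpret M: Metric_space H "hdist X" by (rule metric)
  have "hilbert_space X \<longleftrightarrow> M.mcomplete"
    unfolding hilbert_space_def
    by (intro iffI conjI ballI allI impI; (elim conjE)?;
      (assumption | rule subspace inner_add_right inner_scaleC_right inner_commute inner_nonneg
        inner_eq_zeroD; assumption))
  also have "\<dots> \<longleftrightarrow> (\<forall>a. hcauchy X a \<longrightarrow> (\<exists>x. hconv X a x))"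
    unfolding M.mcomplete_def MCauchy_iff
  proof (intro iff_allI imp_cong refl)
    fix a assume "hcauchy X a"
    then have "range a \<subseteq> H" by (simp add: hcauchy_def)
    then show "(\<exists>x. limitin M.mtopology a x sequentially) \<longleftrightarrow> (\<exists>x. hconv X a x)"
      using limitin_iff[unfolded htopology_def] by simp
  qed
  finally show ?thesis .
qed

lemma hconv_inner:
  assumes "hconv X a x" "hconv X b y"
  shows "(\<lambda>j. ip (a j) (b j)) \<longlonglongrightarrow> ip x y"
proof -
  have mem': "a j \<in> H" "b j \<in> H" "x \<in> H" "y \<in> H" for j
    using assms by (auto simp: hconv_def)
  have l: "(\<lambda>j. nrm (a j - x)) \<longlonglongrightarrow> 0" "(\<lambda>j. nrm (b j - y)) \<longlonglongrightarrow> 0"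
    using assms by (auto simp: hconv_def)
  have lim: "(\<lambda>j. nrm (a j - x) * nrm (b j - y) + nrm (a j - x) * nrm y + nrm x * nrm (b j - y)) \<longlonglongrightarrow> 0"
    by (rule tendsto_eq_intros l refl | simp)+
  have bound: "cmod (ip (a j) (b j) - ip x y) \<le>
    nrm (a j - x) * nrm (b j - y) + nrm (a j - x) * nrm y + nrm x * nrm (b j - y)" for j
  proof -
    have "ip (a j) (b j) - ip x y = ip (a j - x) (b j - y) + ip (a j - x) y + ip x (b j - y)"
      using mem' by (simp add: inner_simps)
    also have "cmod \<dots> \<le> cmod (ip (a j - x) (b j - y)) + cmod (ip (a j - x) y) + cmod (ip x (b j - y))"
      by (intro norm_triangle_mono order_refl)
    also have "\<dots> \<le> nrm (a j - x) * nrm (b j - y) + nrm (a j - x) * nrm y + nrm x * nrm (b j - y)"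
      using mem' by (intro add_mono cauchy_schwarz) auto
    finally show ?thesis .
  qed
  have "(\<lambda>j. ip (a j) (b j) - ip x y) \<longlonglongrightarrow> 0"
    by (rule null_comparison[OF lim bound])
  then show ?thesis by (simp add: LIM_zero_iff)
qed

lemma hconv_const: "x \<in> H \<Longrightarrow> hconv X (\<lambda>_. x) x"
  by (auto simp: hconv_def)

lemma hconv_imp_hcauchy:
  assumes "hconv X a x" shows "hcauchy X a"
  using assms limitin_iff
  by (metis MCauchy_iff Metric_space.convergent_imp_MCauchy hconv_def htopology_def metric)

definition dense :: "'a set \<Rightarrow> bool" where
  "dense S \<longleftrightarrow> S \<subseteq> H \<and> (\<forall>x\<in>H. \<exists>a. range a \<subseteq> S \<and> hconv X a x)"

lemma closure_of_iff:
  assumes S: "S \<subseteq> H"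
  shows "htopology X closure_of S = H \<longleftrightarrow> dense S"
proof -
  interpret M: Metric_space H "hdist X" by (rule metric)
  have "htopology X closure_of S = H \<longleftrightarrow> (\<forall>x\<in>H. \<forall>r>0. \<exists>y\<in>S. y \<in> M.mball x r)"
    unfolding htopology_def M.metric_closure_of by auto
  also have "\<dots> \<longleftrightarrow> (\<forall>x\<in>H. \<exists>a. range a \<subseteq> S \<and> hconv X a x)"
  proof (intro ball_cong refl iffI)
    fix x assume x: "x \<in> H" and *: "\<forall>r>0. \<exists>y\<in>S. y \<in> M.mball x r"
    then have "\<forall>j. \<exists>y. y \<in> S \<and> y \<in> M.mball x (inverse (real (Suc j)))"
      by (meson inverse_positive_iff_positive of_nat_0_less_iff zero_less_Suc)
    then obtain a where a: "\<And>j. a j \<in> S" "\<And>j. a j \<in> M.mball x (inverse (real (Suc j)))" by metis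
    have "norm (nrm (a j - x)) \<le> inverse (real (Suc j))" for j
      using a[of j] S x by (auto simp: hdist_def nrm_minus_commute dest: subsetD)
    then have "(\<lambda>j. nrm (a j - x)) \<longlonglongrightarrow> 0"
      by (rule null_comparison[OF LIMSEQ_inverse_real_of_nat])
    then show "\<exists>a. range a \<subseteq> S \<and> hconv X a x"
      unfolding hconv_def using a S x by blast
  next
    fix x assume x: "x \<in> H" and "\<exists>a. range a \<subseteq> S \<and> hconv X a x"
    then obtain a where a: "range a \<subseteq> S" "hconv X a x" by blast
    show "\<forall>r>0. \<exists>y\<in>S. y \<in> M.mball x r"
    proof (intro allI impI)
      fix r :: real assume "0 < r"
      then have "\<forall>\<^sub>F j in sequentially. nrm (a j - x) < r"
        using a(2) by (auto simp: hconv_def intro: order_tendstoD)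
      then obtain j where "nrm (a j - x) < r" by (auto simp: eventually_sequentially)
      moreover have "a j \<in> S" "a j \<in> H" using a S by auto
      ultimately show "\<exists>y\<in>S. y \<in> M.mball x r"
        using x by (intro bexI[of _ "a j"]) (auto simp: hdist_def nrm_minus_commute)
    qed
  qed
  finally show ?thesis using S by (simp add: dense_def)
qed

lemma dense_eqI:
  assumes S: "dense S" and "x \<in> H" "y \<in> H" and eq: "\<And>z. z \<in> S \<Longrightarrow> ip z x = ip z y"
  shows "x = y"
proof (rule eqI_inner[OF assms(2,3)])
  fix z assume "z \<in> H"
  then obtain a where a: "range a \<subseteq> S" "hconv X a z" using S by (auto simp: dense_def)
  show "ip z x = ip z y"
  proof (rule LIMSEQ_unique)
    show "(\<lambda>j. ip (a j) x) \<longlonglongrightarrow> ip z x"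
      using a assms by (intro hconv_inner hconv_const) auto
    have "ip (a j) x = ip (a j) y" for j using a eq by auto
    then show "(\<lambda>j. ip (a j) x) \<longlonglongrightarrow> ip z y"
      using a assms by (simp add: hconv_inner hconv_const)
  qed
qed

text \<open>Two vectors with the defining property have equal inner products with all of
  \<open>H\<close>. Wherever an adjoint can be written down, this evaluates the definite
  description.\<close>

lemma hadjoint_eqI:
  assumes "z \<in> H" "\<And>x. x \<in> H \<Longrightarrow> hinner Y (T x) y = ip x z"
  shows "hadjoint X Y T y = z"
  unfolding hadjoint_def
  by (rule the_equality) (use assms in \<open>auto intro: eqI_inner\<close>)

end

section \<open>Cauchy sequences and limits of inner products\<close>

context semi_inner_space
begin

lemma hcauchyD: "hcauchy X a \<Longrightarrow> a j \<in> H"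
  by (auto simp: hcauchy_def)

lemma hcauchyE:
  assumes "hcauchy X a" "0 < e"
  obtains N where "\<And>i j. N \<le> i \<Longrightarrow> N \<le> j \<Longrightarrow> nrm (a i - a j) < e"
  using assms unfolding hcauchy_def by blast

lemma hcauchyI:
  assumes "\<And>j. a j \<in> H"
    and "\<And>e. 0 < e \<Longrightarrow> \<exists>N. \<forall>i j. N \<le> i \<longrightarrow> N \<le> j \<longrightarrow> nrm (a i - a j) < e"
  shows "hcauchy X a"
  using assms unfolding hcauchy_def by blast

lemma hcauchy_bounded:
  assumes a: "hcauchy X a"
  obtains M where "0 < M" "\<And>j. nrm (a j) \<le> M"
proof -
  obtain N where N: "\<And>i j. N \<le> i \<Longrightarrow> N \<le> j \<Longrightarrow> nrm (a i - a j) < 1"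
    using a hcauchyE[of a 1] by (metis zero_less_one)
  define M where "M = Max ((\<lambda>j. nrm (a j)) ` {..N}) + 1"
  have le: "nrm (a j) \<le> M - 1" if "j \<le> N" for j
    using that by (auto simp: M_def)
  have "nrm (a j) \<le> M" for j
  proof (cases "j \<le> N")
    case True then show ?thesis using le[of j] by linarith
  next
    case False
    then have "nrm (a j) \<le> nrm (a N) + 1"
      using N[of j N] triangle_reverse[of "a j" "a N"] hcauchyD[OF a] by fastforce
    then show ?thesis using le[of N] by simp
  qed
  moreover have "0 < M" using le[of 0] nrm_nonneg[OF hcauchyD[OF a], of 0] by linarith
  ultimately show thesis using that by blast
qed

lemma hcauchy_const: "x \<in> H \<Longrightarrow> hcauchy X (\<lambda>_. x)"
  by (rule hcauchyI) auto

lemma hcauchy_add: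
  assumes a: "hcauchy X a" and b: "hcauchy X b"
  shows "hcauchy X (\<lambda>j. a j + b j)"
proof (rule hcauchyI)
  show "a j + b j \<in> H" for j using hcauchyD a b by blast
  fix e :: real assume "0 < e"
  then have e: "0 < e / 2" by simp
  obtain N where N: "\<And>i j. N \<le> i \<Longrightarrow> N \<le> j \<Longrightarrow> nrm (a i - a j) < e / 2"
    using hcauchyE[OF a e] by blast
  obtain N' where N': "\<And>i j. N' \<le> i \<Longrightarrow> N' \<le> j \<Longrightarrow> nrm (b i - b j) < e / 2"
    using hcauchyE[OF b e] by blast
  have "nrm (a i + b i - (a j + b j)) < e" if "max N N' \<le> i" "max N N' \<le> j" for i j
  proof -
    have "nrm (a i + b i - (a j + b j)) \<le> nrm (a i - a j) + nrm (b i - b j)"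
      using triangle[of "a i - a j" "b i - b j"] hcauchyD[OF a] hcauchyD[OF b]
      by (simp add: algebra_simps)
    then show ?thesis using N[of i j] N'[of i j] that by simp
  qed
  then show "\<exists>N. \<forall>i j. N \<le> i \<longrightarrow> N \<le> j \<longrightarrow> nrm (a i + b i - (a j + b j)) < e" by blast
qed

lemma hcauchy_scaleC:
  assumes a: "hcauchy X a"
  shows "hcauchy X (\<lambda>j. c *\<^sub>C a j)"
proof (rule hcauchyI)
  show "c *\<^sub>C a j \<in> H" for j using hcauchyD a by blast
  fix e :: real assume "0 < e"
  then have e: "0 < e / (cmod c + 1)" by (simp add: add_nonneg_pos)
  obtain N where N: "\<And>i j. N \<le> i \<Longrightarrow> N \<le> j \<Longrightarrow> nrm (a i - a j) < e / (cmod c + 1)"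
    using hcauchyE[OF a e] by blast
  have "nrm (c *\<^sub>C a i - c *\<^sub>C a j) < e" if "N \<le> i" "N \<le> j" for i j
  proof -
    have d: "a i - a j \<in> H" using hcauchyD[OF a] by blast
    have "nrm (c *\<^sub>C a i - c *\<^sub>C a j) = cmod c * nrm (a i - a j)"
      using nrm_scaleC[OF d] by (simp add: complex_vector.scale_right_diff_distrib)
    also have "\<dots> \<le> (cmod c + 1) * nrm (a i - a j)"
      using nrm_nonneg[OF d] by (simp add: algebra_simps)
    also have "\<dots> < e"
      using N[OF that] by (simp add: pos_less_divide_eq add_nonneg_pos mult.commute)
    finally show ?thesis .
  qed
  then show "\<exists>N. \<forall>i j. N \<le> i \<longrightarrow> N \<le> j \<longrightarrow> nrm (c *\<^sub>C a i - c *\<^sub>C a j) < e" by blast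
qed

lemma hcauchy_diff:
  "hcauchy X a \<Longrightarrow> hcauchy X b \<Longrightarrow> hcauchy X (\<lambda>j. a j - b j)"
  using hcauchy_add[of a "\<lambda>j. (-1) *\<^sub>C b j"] hcauchy_scaleC[of b "-1"] by simp

text \<open>The vectors themselves may have no limit; the scalars form a Cauchy sequence of complex
  numbers. The limit becomes the inner product on the completion.\<close>

lemma hcauchy_inner_convergent:
  assumes a: "hcauchy X a" and b: "hcauchy X b"
  shows "convergent (\<lambda>j. ip (a j) (b j))"
proof -
  obtain M where M: "0 < M" "\<And>j. nrm (a j) \<le> M" using hcauchy_bounded[OF a] by blast
  obtain M' where M': "0 < M'" "\<And>j. nrm (b j) \<le> M'" using hcauchy_bounded[OF b] by blast
  have mem': "a j \<in> H" "b j \<in> H" for j using hcauchyD a b by blast+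
  have "Cauchy (\<lambda>j. ip (a j) (b j))"
  proof (rule metric_CauchyI)
    fix e :: real assume "0 < e"
    with M M' have e: "0 < e / (2 * M')" "0 < e / (2 * M)" by simp_all
    obtain N where N: "\<And>i j. N \<le> i \<Longrightarrow> N \<le> j \<Longrightarrow> nrm (a i - a j) < e / (2 * M')"
      using hcauchyE[OF a e(1)] by blast
    obtain N' where N': "\<And>i j. N' \<le> i \<Longrightarrow> N' \<le> j \<Longrightarrow> nrm (b i - b j) < e / (2 * M)"
      using hcauchyE[OF b e(2)] by blast
    have "dist (ip (a i) (b i)) (ip (a j) (b j)) < e" if "max N N' \<le> i" "max N N' \<le> j" for i j
    proof -
      have "ip (a i) (b i) - ip (a j) (b j) = ip (a i - a j) (b i) + ip (a j) (b i - b j)"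
        using mem' by (simp add: inner_simps)
      also have "cmod \<dots> \<le> cmod (ip (a i - a j) (b i)) + cmod (ip (a j) (b i - b j))"
        by (rule norm_triangle_ineq)
      also have "\<dots> \<le> nrm (a i - a j) * nrm (b i) + nrm (a j) * nrm (b i - b j)"
        using mem' by (intro add_mono cauchy_schwarz) auto
      also have "\<dots> \<le> nrm (a i - a j) * M' + M * nrm (b i - b j)"
        using mem' M M' by (intro add_mono mult_left_mono mult_right_mono) auto
      also have "\<dots> < e / (2 * M') * M' + M * (e / (2 * M))"
        using N[of i j] N'[of i j] that M(1) M'(1)
        by (intro add_strict_mono mult_strict_left_mono mult_strict_right_mono) auto
      also have "\<dots> = e" using M(1) M'(1) by simp
      finally show ?thesis by (simp add: dist_norm)
    qed
    then show "\<exists>N. \<forall>i\<ge>N. \<forall>j\<ge>N. dist (ip (a i) (b i)) (ip (a j) (b j)) < e" by blast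
  qed
  then show ?thesis by (simp add: Cauchy_convergent_iff)
qed

text \<open>This and its mirror image make the inner product on the completion independent of the
  representing sequences.\<close>

lemma inner_null_left:
  assumes a: "\<And>j. a j \<in> H" "(\<lambda>j. nrm (a j)) \<longlonglongrightarrow> 0" and b: "hcauchy X b"
  shows "(\<lambda>j. ip (a j) (b j)) \<longlonglongrightarrow> 0"
proof -
  obtain M where M: "0 < M" "\<And>j. nrm (b j) \<le> M" using hcauchy_bounded[OF b] by blast
  have "(\<lambda>j. nrm (a j) * M) \<longlonglongrightarrow> 0" using tendsto_mult_right[OF a(2), of M] by simp
  moreover have "cmod (ip (a j) (b j)) \<le> nrm (a j) * M" for j
    using cauchy_schwarz[OF a(1) hcauchyD[OF b], of j j] mult_left_mono[OF M(2) nrm_nonneg[OF a(1)], of j j]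
    by linarith
  ultimately show ?thesis by (rule null_comparison)
qed

lemma inner_null_right:
  assumes a: "hcauchy X a" and b: "\<And>j. b j \<in> H" "(\<lambda>j. nrm (b j)) \<longlonglongrightarrow> 0"
  shows "(\<lambda>j. ip (a j) (b j)) \<longlonglongrightarrow> 0"
proof -
  have "ip (a j) (b j) = cnj (ip (b j) (a j))" for j
    using inner_commute[OF b(1) hcauchyD[OF a]] .
  then show ?thesis using tendsto_cnj[OF inner_null_left[OF b a]] by simp
qed

end

section \<open>The Riesz representation theorem and isomorphisms\<close>

locale hilbert = inner_space +
  assumes complete: "hcauchy X a \<Longrightarrow> \<exists>x. hconv X a x"
begin

text \<open>\<open>F\<close> is antilinear because inner products are linear in the second variable.
  If \<open>F x = ip x z\<close>, then \<open>\<Phi> x\<close> below is the square of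
  \<open>nrm (x - z)\<close> minus that of \<open>nrm z\<close>, so \<open>z\<close> is sought as a
  minimizer of \<open>\<Phi>\<close>.\<close>

lemma riesz:
  fixes F :: "'a \<Rightarrow> complex"
  assumes add: "\<And>x y. x \<in> H \<Longrightarrow> y \<in> H \<Longrightarrow> F (x + y) = F x + F y"
    and scale: "\<And>c x. x \<in> H \<Longrightarrow> F (c *\<^sub>C x) = cnj c * F x"
    and bound: "\<And>x. x \<in> H \<Longrightarrow> cmod (F x) \<le> K * nrm x"
  shows "\<exists>z\<in>H. \<forall>x\<in>H. F x = ip x z"
proof -
  define \<Phi> where "\<Phi> x = (nrm x)\<^sup>2 - 2 * Re (F x)" for x
  have \<Phi>_ge: "- K\<^sup>2 \<le> \<Phi> x" if "x \<in> H" for x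
  proof -
    have "Re (F x) \<le> K * nrm x" using bound[OF that] complex_Re_le_cmod order_trans by blast
    moreover have "0 \<le> (nrm x - K)\<^sup>2" by simp
    ultimately show ?thesis by (simp add: \<Phi>_def power2_diff mult.commute)
  qed
  then have bdd: "bdd_below (\<Phi> ` H)" by (auto intro!: bdd_belowI[of _ "- K\<^sup>2"])
  define I where "I = Inf (\<Phi> ` H)"
  have I_le: "I \<le> \<Phi> x" if "x \<in> H" for x
    unfolding I_def by (rule cINF_lower[OF bdd that])
  have "\<exists>x. x \<in> H \<and> \<Phi> x < I + inverse (real (Suc j))" for j
  proof -
    have "\<Phi> ` H \<noteq> {}" using mem(1) by blast
    moreover have "Inf (\<Phi> ` H) < I + inverse (real (Suc j))" by (simp add: I_def)
    ultimately obtain y where "y \<in> \<Phi> ` H" "y < I + inverse (real (Suc j))"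
      using cInf_lessD[of "\<Phi> ` H" "I + inverse (real (Suc j))"] by blast
    then show ?thesis by auto
  qed
  then obtain a where a: "\<And>j. a j \<in> H" "\<And>j. \<Phi> (a j) < I + inverse (real (Suc j))" by metis
  \<comment> \<open>Parallelogram law, with \<open>\<Phi>\<close> at the midpoint bounded below by
    \<open>I\<close>: nearly minimal points are close to each other.\<close>
  have close: "(nrm (a i - a j))\<^sup>2 \<le> 2 * inverse (real (Suc i)) + 2 * inverse (real (Suc j))" for i j
  proof -
    define m where "m = (1 / 2) *\<^sub>C (a i + a j)"
    have nm: "nrm m = nrm (a i + a j) / 2" using a by (simp add: m_def nrm_scaleC)
    have "F m = (F (a i) + F (a j)) / 2" using a by (simp add: m_def scale add)
    then have Fm: "Re (F m) = (Re (F (a i)) + Re (F (a j))) / 2"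
      by (simp only: Re_divide_numeral plus_complex.sel)
    have "4 * \<Phi> m = (nrm (a i + a j))\<^sup>2 - 4 * Re (F (a i)) - 4 * Re (F (a j))"
      unfolding \<Phi>_def nm Fm by (simp add: power_divide field_simps)
    moreover have "I \<le> \<Phi> m" by (rule I_le) (use a in \<open>auto simp: m_def\<close>)
    ultimately show ?thesis
      using parallelogram[of "a i" "a j"] a(1)[of i] a(1)[of j] a(2)[of i] a(2)[of j]
      unfolding \<Phi>_def by argo
  qed
  have "hcauchy X a"
    unfolding hcauchy_def
  proof (intro conjI allI impI)
    show "range a \<subseteq> H" using a by auto
    fix e :: real assume "0 < e"
    then obtain N where N: "inverse (real (Suc N)) < e\<^sup>2 / 4"
      using reals_Archimedean[of "e\<^sup>2 / 4"] by auto
    have "nrm (a i - a j) < e" if "N \<le> i" "N \<le> j" for i j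
    proof -
      have "inverse (real (Suc i)) \<le> inverse (real (Suc N))"
        "inverse (real (Suc j)) \<le> inverse (real (Suc N))"
        using that by (auto intro!: le_imp_inverse_le)
      then have "(nrm (a i - a j))\<^sup>2 < e\<^sup>2" using close[of i j] N by linarith
      then show ?thesis using \<open>0 < e\<close> by (meson less_imp_le power2_less_imp_less)
    qed
    then show "\<exists>N. \<forall>i j. N \<le> i \<longrightarrow> N \<le> j \<longrightarrow> nrm (a i - a j) < e" by blast
  qed
  then obtain z where z: "hconv X a z" using complete by blast
  then have zH: "z \<in> H" by (simp add: hconv_def)
  have "F v = ip v z" if v: "v \<in> H" for v
  proof -
    \<comment> \<open>First variation in the direction \<open>v\<close>, carried out at the nearly
      minimal \<open>a j\<close> up to an error \<open>inverse (real (Suc j))\<close> and then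
      passed to the limit \<open>z\<close>.\<close>
    have pos: "0 \<le> 2 * Re (cnj t * (ip v z - F v)) + (cmod t * nrm v)\<^sup>2" for t
    proof -
      have "- inverse (real (Suc j)) \<le> 2 * Re (cnj t * (ip v (a j) - F v)) + (cmod t * nrm v)\<^sup>2" for j
      proof -
        have "I \<le> \<Phi> (a j + t *\<^sub>C v)" by (rule I_le) (use a v in auto)
        also have "\<dots> = \<Phi> (a j) + 2 * Re (cnj t * (ip v (a j) - F v)) + (cmod t * nrm v)\<^sup>2"
          using a(1)[of j] v inner_commute_Re[of "t *\<^sub>C v" "a j"]
          by (simp add: \<Phi>_def nrm_add_square nrm_scaleC add scale inner_scaleC_left algebra_simps)
        finally show ?thesis using a(2)[of j] by linarith
      qed
      moreover have "(\<lambda>j. - inverse (real (Suc j))) \<longlonglongrightarrow> 0"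
        using tendsto_minus[OF LIMSEQ_inverse_real_of_nat] by simp
      moreover have "(\<lambda>j. 2 * Re (cnj t * (ip v (a j) - F v)) + (cmod t * nrm v)\<^sup>2)
        \<longlonglongrightarrow> 2 * Re (cnj t * (ip v z - F v)) + (cmod t * nrm v)\<^sup>2"
        by (intro tendsto_intros hconv_inner hconv_const v z)
      ultimately show ?thesis by (meson LIMSEQ_le)
    qed
    define c where "c = ip v z - F v"
    \<comment> \<open>Moving against \<open>c\<close> with this step length keeps the quadratic term
      below the linear one, which forces \<open>c = 0\<close>. The summand 1 covers
      \<open>v = 0\<close>.\<close>
    define s where "s = 1 / ((nrm v)\<^sup>2 + 1)"
    have s: "0 < s" "s * (nrm v)\<^sup>2 < 1"
      by (auto simp: s_def field_simps add_pos_nonneg add_nonneg_pos)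
    have e1: "2 * Re (cnj (- of_real s * c) * c) = - 2 * s * (cmod c)\<^sup>2"
      unfolding cmod_power2 by (simp add: power2_eq_square algebra_simps)
    have e2: "(cmod (- of_real s * c) * nrm v)\<^sup>2 = s * (s * (nrm v)\<^sup>2) * (cmod c)\<^sup>2"
      by (simp add: norm_mult power_mult_distrib power2_eq_square)
    have "0 \<le> - (s * (2 - s * (nrm v)\<^sup>2) * (cmod c)\<^sup>2)"
      using pos[of "- of_real s * c", folded c_def, unfolded e1 e2] by (simp add: algebra_simps)
    moreover have "0 < s * (2 - s * (nrm v)\<^sup>2)" using s by (intro mult_pos_pos) auto
    ultimately have "(cmod c)\<^sup>2 \<le> 0"
      by (metis mult_le_0_iff neg_0_le_iff_le not_less)
    then show ?thesis by (simp add: c_def)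
  qed
  then show ?thesis using zH by blast
qed

end

lemma hilbert_iff: "hilbert_space X \<longleftrightarrow> hilbert X"
proof
  assume X: "hilbert_space X"
  note X' = X[unfolded hilbert_space_def]
  interpret inner_space X
    by unfold_locales
      (fact X'[THEN conjunct1]
       | erule (2) X'[THEN conjunct2, THEN conjunct1, rule_format]
       | erule (1) X'[THEN conjunct2, THEN conjunct2, THEN conjunct1, rule_format]
       | erule (1) X'[THEN conjunct2, THEN conjunct2, THEN conjunct2, THEN conjunct1, rule_format]
       | erule X'[THEN conjunct2, THEN conjunct2, THEN conjunct2, THEN conjunct2, THEN conjunct1, rule_format]
       | erule (1) X'[THEN conjunct2, THEN conjunct2, THEN conjunct2, THEN conjunct2, THEN conjunct2, THEN conjunct1, rule_format])+
  show "hilbert X"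
    using X unfolding hilbert_space_iff by unfold_locales simp
next
  assume "hilbert X"
  then interpret hilbert X .
  show "hilbert_space X" using complete hilbert_space_iff by blast
qed

locale bounded_operator = X: hilbert X + Y: inner_space Y
  for X :: "'h::complex_vector hspace" and Y :: "'k::complex_vector hspace" +
  fixes T
  assumes bounded: "bounded_op X Y T"
begin

text \<open>For fixed \<open>y\<close> the functional sending \<open>x\<close> to
  \<open>hinner Y (T x) y\<close> is antilinear and bounded, so \<open>riesz\<close> represents it
  and the description in \<open>hadjoint\<close> is proper.\<close>

lemma adjoint:
  assumes y: "y \<in> hcarrier Y"
  shows adjoint_mem: "hadjoint X Y T y \<in> hcarrier X"
    and adjoint_inner: "x \<in> hcarrier X \<Longrightarrow> hinner Y (T x) y = hinner X x (hadjoint X Y T y)"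
proof -
  have T: "T x \<in> hcarrier Y" if "x \<in> hcarrier X" for x
    using bounded that by (auto simp: bounded_op_def)
  obtain K where K: "\<And>x. x \<in> hcarrier X \<Longrightarrow> hnorm Y (T x) \<le> K * hnorm X x"
    using bounded unfolding bounded_op_def by blast
  have "\<exists>z\<in>hcarrier X. \<forall>x\<in>hcarrier X. hinner Y (T x) y = hinner X x z"
  proof (rule X.riesz)
    fix x assume x: "x \<in> hcarrier X"
    have "cmod (hinner Y (T x) y) \<le> hnorm Y (T x) * hnorm Y y"
      using Y.cauchy_schwarz T x y by blast
    also have "\<dots> \<le> K * hnorm X x * hnorm Y y"
      using K[OF x] y by (simp add: mult_right_mono)
    finally show "cmod (hinner Y (T x) y) \<le> K * hnorm Y y * hnorm X x"
      by (simp add: mult_ac)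
  qed (use bounded T y in \<open>auto simp: bounded_op_def Y.inner_simps\<close>)
  then obtain z where z: "z \<in> hcarrier X" "\<And>x. x \<in> hcarrier X \<Longrightarrow> hinner Y (T x) y = hinner X x z"
    by blast
  then have "hadjoint X Y T y = z" by (intro X.hadjoint_eqI) auto
  then show "hadjoint X Y T y \<in> hcarrier X"
    "x \<in> hcarrier X \<Longrightarrow> hinner Y (T x) y = hinner X x (hadjoint X Y T y)"
    using z by auto
qed

end

text \<open>Density is asked of the ranges rather than of their spans. Every vector is then a limit
  of members \<open>v (r j)\<close>, and the same indices \<open>r j\<close> can be used on the
  other side.\<close>

locale gram_pair = X: hilbert X + Y: hilbert Y
  for X :: "'h::complex_vector hspace" and Y :: "'k::complex_vector hspace" +
  fixes v :: "'s \<Rightarrow> 'h" and w :: "'s \<Rightarrow> 'k"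
  assumes dense_v: "X.dense (range v)" and dense_w: "Y.dense (range w)"
    and gram: "hinner X (v s) (v t) = hinner Y (w s) (w t)"
begin

lemma v_mem: "v s \<in> hcarrier X" using dense_v by (auto simp: X.dense_def)
lemma w_mem: "w s \<in> hcarrier Y" using dense_w by (auto simp: Y.dense_def)

lemma norm_eq: "hnorm X (v s - v t) = hnorm Y (w s - w t)"
  using gram by (simp add: hnorm_def X.inner_simps Y.inner_simps v_mem w_mem)

text \<open>The image is described by its inner products with the dense family instead of by
  extending \<open>v s\<close> to \<open>w s\<close>; well-definedness and linearity thereby reduce
  to \<open>iso_unique\<close>.\<close>

definition iso :: "'h \<Rightarrow> 'k" where
  "iso x = (THE y. y \<in> hcarrier Y \<and> (\<forall>s. hinner Y (w s) y = hinner X (v s) x))"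

lemma iso_unique:
  assumes "y \<in> hcarrier Y" "\<And>s. hinner Y (w s) y = hinner X (v s) x"
  shows "iso x = y"
  unfolding iso_def
proof (rule the_equality)
  fix y' assume y': "y' \<in> hcarrier Y \<and> (\<forall>s. hinner Y (w s) y' = hinner X (v s) x)"
  show "y' = y" by (rule Y.dense_eqI[OF dense_w]) (use assms y' in auto)
qed (use assms in auto)

text \<open>Norms of differences are determined by the Gram matrix, so the Cauchy property passes
  from one side to the other. Completeness of \<open>Y\<close> supplies a limit, and
  \<open>gram\<close> shows that it has the inner products demanded of \<open>iso x\<close>.\<close>

lemma iso_limit:
  assumes "hconv X (\<lambda>j. v (r j)) x"
  shows "hconv Y (\<lambda>j. w (r j)) (iso x)"
proof -
  have "hcauchy X (\<lambda>j. v (r j))" using assms by (rule X.hconv_imp_hcauchy)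
  then have "hcauchy Y (\<lambda>j. w (r j))"
    using w_mem by (auto simp: hcauchy_def norm_eq)
  then obtain y where y: "hconv Y (\<lambda>j. w (r j)) y" using Y.complete by blast
  have "hinner Y (w s) y = hinner X (v s) x" for s
  proof (rule LIMSEQ_unique)
    show "(\<lambda>j. hinner Y (w s) (w (r j))) \<longlonglongrightarrow> hinner Y (w s) y"
      by (intro Y.hconv_inner Y.hconv_const w_mem y)
    show "(\<lambda>j. hinner Y (w s) (w (r j))) \<longlonglongrightarrow> hinner X (v s) x"
      unfolding gram[symmetric] by (intro X.hconv_inner X.hconv_const v_mem assms)
  qed
  then have "iso x = y" using y by (intro iso_unique) (auto simp: hconv_def)
  then show ?thesis using y by simp
qed

lemma approx: assumes "x \<in> hcarrier X" obtains r where "hconv X (\<lambda>j. v (r j)) x"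
proof -
  obtain a where a: "range a \<subseteq> range v" "hconv X a x"
    using dense_v assms by (auto simp: X.dense_def)
  then have "\<forall>j. \<exists>s. a j = v s" by auto
  then obtain r where "\<And>j. a j = v (r j)" by metis
  then have "a = (\<lambda>j. v (r j))" by auto
  then show thesis using a that by simp
qed

lemma iso_mem: "x \<in> hcarrier X \<Longrightarrow> iso x \<in> hcarrier Y"
  by (metis approx iso_limit hconv_def)

lemma inner_iso: assumes "x \<in> hcarrier X" shows "hinner Y (w s) (iso x) = hinner X (v s) x"
proof -
  obtain r where r: "hconv X (\<lambda>j. v (r j)) x" using assms by (rule approx)
  show ?thesis
  proof (rule LIMSEQ_unique)
    show "(\<lambda>j. hinner Y (w s) (w (r j))) \<longlonglongrightarrow> hinner Y (w s) (iso x)"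
      by (intro Y.hconv_inner Y.hconv_const w_mem iso_limit r)
    show "(\<lambda>j. hinner Y (w s) (w (r j))) \<longlonglongrightarrow> hinner X (v s) x"
      unfolding gram[symmetric] by (intro X.hconv_inner X.hconv_const v_mem r)
  qed
qed

lemma isometry:
  assumes "x \<in> hcarrier X" "y \<in> hcarrier X"
  shows "hinner Y (iso x) (iso y) = hinner X x y"
proof -
  obtain r where r: "hconv X (\<lambda>j. v (r j)) x" using assms(1) by (rule approx)
  show ?thesis
  proof (rule LIMSEQ_unique)
    show "(\<lambda>j. hinner Y (w (r j)) (iso y)) \<longlonglongrightarrow> hinner Y (iso x) (iso y)"
      by (intro Y.hconv_inner Y.hconv_const iso_limit iso_mem assms r)
    show "(\<lambda>j. hinner Y (w (r j)) (iso y)) \<longlonglongrightarrow> hinner X x y"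
      unfolding inner_iso[OF assms(2)] by (intro X.hconv_inner X.hconv_const assms r)
  qed
qed

lemma bounded_iso: "bounded_op X Y iso"
  unfolding bounded_op_def
proof (intro conjI ballI allI)
  show "iso \<in> hcarrier X \<rightarrow> hcarrier Y" using iso_mem by auto
  show "iso (x + y) = iso x + iso y" if "x \<in> hcarrier X" "y \<in> hcarrier X" for x y
    using that by (intro iso_unique)
      (auto simp: iso_mem inner_iso X.inner_add_right Y.inner_add_right v_mem w_mem)
  show "iso (c *\<^sub>C x) = c *\<^sub>C iso x" if "x \<in> hcarrier X" for c x
    using that by (intro iso_unique)
      (auto simp: iso_mem inner_iso X.inner_scaleC_right Y.inner_scaleC_right v_mem w_mem)
  show "\<exists>K. \<forall>x\<in>hcarrier X. hnorm Y (iso x) \<le> K * hnorm X x"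
    by (rule exI[of _ 1]) (simp add: hnorm_def isometry)
qed

end

text \<open>The assumptions are symmetric in the two families; the exchanged instance supplies the
  inverse of \<open>iso\<close>, which is also its adjoint.\<close>

sublocale gram_pair \<subseteq> swap: gram_pair Y X w v
  by unfold_locales (auto simp: dense_v dense_w gram)

context gram_pair
begin

lemma iso_swap: "y \<in> hcarrier Y \<Longrightarrow> iso (swap.iso y) = y"
  by (rule iso_unique) (auto simp: swap.inner_iso swap.iso_mem)

lemma unitary_iso: "unitary_op X Y iso"
proof -
  have "hadjoint X Y iso y = swap.iso y" if "y \<in> hcarrier Y" for y
    by (rule X.hadjoint_eqI) (metis isometry iso_swap swap.iso_mem that)+
  moreover have "swap.iso (iso x) = x" if "x \<in> hcarrier X" for x
    by (rule swap.iso_unique) (use that in \<open>auto simp: inner_iso\<close>)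
  ultimately show ?thesis
    unfolding unitary_op_def using bounded_iso iso_swap iso_mem by simp
qed

end

section \<open>Reproducing kernel Hilbert spaces\<close>

text \<open>
  The sections of the kernel are assumed to form a vector space, so that their span need not be
  taken.
\<close>

locale reproducing_kernel =
  fixes K :: "'x \<Rightarrow> 'x \<Rightarrow> complex"
  assumes sections_subspace: "complex_vector.subspace (range (\<lambda>t s. K s t))"
    and hermitian: "K t s = cnj (K s t)"
    and kernel_nonneg: "K s s \<in> \<real>\<^sub>\<ge>\<^sub>0"
begin

definition k :: "'x \<Rightarrow> 'x \<Rightarrow> complex" where
  "k t = (\<lambda>s. K s t)"

text \<open>Different indices may give the same section. The inner product picks one of them for the
  first argument; Hermitian symmetry makes the choice harmless, see \<open>inner_D\<close>.\<close>

definition D :: "('x \<Rightarrow> complex) hspace" where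
  "D = \<lparr>hcarrier = range k, hinner = (\<lambda>a b. b (SOME s. a = k s))\<rparr>"

lemma carrier_D [simp]: "hcarrier D = range k"
  by (simp add: D_def)

lemma inner_D: assumes "b \<in> range k" shows "hinner D (k s) b = b s"
proof -
  obtain t where b: "b = k t" using assms by blast
  define s' where "s' = (SOME s'. k s = k s')"
  have "k s = k s'" unfolding s'_def by (rule someI) (rule refl)
  then have "k s t = k s' t" by simp
  then have "cnj (k t s) = cnj (k t s')" using hermitian[of t] by (simp add: k_def)
  then show ?thesis by (simp add: D_def b s'_def)
qed

lemma inner_kk: "hinner D (k s) (k t) = K s t"
  by (subst inner_D) (auto simp: k_def)

end

sublocale reproducing_kernel \<subseteq> D: inner_space D
proof -
  interpret semi_inner_space D
  proof
    show sub: "complex_vector.subspace (hcarrier D)"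
      using sections_subspace unfolding carrier_D k_def[abs_def] .
    show "hinner D x (y + z) = hinner D x y + hinner D x z"
      if "x \<in> hcarrier D" "y \<in> hcarrier D" "z \<in> hcarrier D" for x y z
    proof -
      have yz: "y \<in> range k" "z \<in> range k" using that by simp_all
      then have "y + z \<in> range k" using complex_vector.subspace_add[OF sub] by simp
      moreover from that obtain s where "x = k s" by auto
      ultimately show ?thesis using yz inner_D[of "y + z" s] inner_D[of y s] inner_D[of z s] by simp
    qed
    show "hinner D x (c *\<^sub>C y) = c * hinner D x y" if "x \<in> hcarrier D" "y \<in> hcarrier D" for x y c
    proof -
      have y: "y \<in> range k" using that by simp
      then have "c *\<^sub>C y \<in> range k" using complex_vector.subspace_scale[OF sub] by simp
      moreover from that obtain s where "x = k s" by auto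
      ultimately show ?thesis using y inner_D[of "c *\<^sub>C y" s] inner_D[of y s]
        by (simp add: scaleC_fun_def scaleC_complex_def)
    qed
    show "hinner D y x = cnj (hinner D x y)" if "x \<in> hcarrier D" "y \<in> hcarrier D" for x y
      using that by (auto simp: inner_kk intro: hermitian)
    show "hinner D x x \<in> \<real>\<^sub>\<ge>\<^sub>0" if "x \<in> hcarrier D" for x
      using that kernel_nonneg by (auto simp: inner_kk)
  qed
  show "inner_space D"
  proof unfold_locales
    fix x assume x: "x \<in> hcarrier D" "hinner D x x = 0"
    show "x = 0"
    proof
      fix s
      \<comment> \<open>Evaluation at \<open>s\<close> is the inner product with \<open>k s\<close>,
        so a vector of norm 0 vanishes pointwise.\<close>
      have "cmod (hinner D (k s) x) \<le> hnorm D (k s) * hnorm D x"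
        using x by (intro cauchy_schwarz) auto
      then show "x s = 0 s" using x by (simp add: inner_D hnorm_def)
    qed
  qed
qed

section \<open>The completion as a space of functions\<close>

context reproducing_kernel
begin

text \<open>A class of Cauchy sequences is to be replaced by its pointwise limit. That the limit
  function determines the class is the content of \<open>approx_null\<close>.\<close>

definition approx :: "(nat \<Rightarrow> 'x \<Rightarrow> complex) \<Rightarrow> ('x \<Rightarrow> complex) \<Rightarrow> bool" where
  "approx a \<xi> \<longleftrightarrow> hcauchy D a \<and> (\<forall>s. (\<lambda>j. a j s) \<longlonglongrightarrow> \<xi> s)"

text \<open>The square of the norm of \<open>a j\<close> splits into the inner products with
  \<open>a j\<close> of \<open>a j - a N\<close>, small by the Cauchy condition, and of
  \<open>a N\<close>. As \<open>a N\<close> is a section \<open>k s\<close>, the latter is the value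
  \<open>a j s\<close>, which tends to 0.\<close>

lemma approx_null:
  assumes "approx a 0"
  shows "(\<lambda>j. hnorm D (a j)) \<longlonglongrightarrow> 0"
proof -
  have a: "hcauchy D a" and pt: "(\<lambda>j. a j s) \<longlonglongrightarrow> 0" for s
    using assms by (auto simp: approx_def)
  have mem: "a j \<in> hcarrier D" for j using D.hcauchyD a by blast
  obtain M where M: "0 < M" "\<And>j. hnorm D (a j) \<le> M" using D.hcauchy_bounded[OF a] by blast
  have "(\<lambda>j. (hnorm D (a j))\<^sup>2) \<longlonglongrightarrow> 0"
  proof (rule LIMSEQ_I)
    fix e :: real assume "0 < e"
    then have e: "0 < e / (2 * M)" "0 < e / 2" using M(1) by simp_all
    obtain N where N: "\<And>i j. N \<le> i \<Longrightarrow> N \<le> j \<Longrightarrow> hnorm D (a i - a j) < e / (2 * M)"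
      using D.hcauchyE[OF a e(1)] by blast
    obtain s where s: "a N = k s" using mem[of N] by auto
    obtain N' where N': "\<And>j. N' \<le> j \<Longrightarrow> cmod (a j s) < e / 2"
      using LIMSEQ_D[OF pt e(2)] by auto
    have "norm ((hnorm D (a j))\<^sup>2 - 0) < e" if "max N N' \<le> j" for j
    proof -
      have "complex_of_real ((hnorm D (a j))\<^sup>2) = hinner D (a j) (a j)"
        using D.inner_self[OF mem] by simp
      also have "\<dots> = hinner D (a j - a N) (a j) + a j s"
        using mem[of j] mem[of N] inner_D[of "a j" s] by (simp add: D.inner_simps s)
      finally have "norm ((hnorm D (a j))\<^sup>2) = cmod (hinner D (a j - a N) (a j) + a j s)"
        by (metis norm_of_real real_norm_def)
      also have "\<dots> \<le> cmod (hinner D (a j - a N) (a j)) + cmod (a j s)"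
        by (rule norm_triangle_ineq)
      also have "cmod (hinner D (a j - a N) (a j)) \<le> hnorm D (a j - a N) * hnorm D (a j)"
        by (intro D.cauchy_schwarz D.mem mem)
      also have "\<dots> \<le> hnorm D (a j - a N) * M"
        by (intro mult_left_mono M D.nrm_nonneg D.mem mem)
      also have "\<dots> \<le> e / (2 * M) * M"
        using N[of j N] that M(1) by (intro mult_right_mono) auto
      also have "\<dots> = e / 2" using M(1) by simp
      also have "e / 2 + cmod (a j s) < e" using N'[of j] that by simp
      finally show ?thesis by simp
    qed
    then show "\<exists>N. \<forall>j\<ge>N. norm ((hnorm D (a j))\<^sup>2 - 0) < e" by blast
  qed
  then have "(\<lambda>j. sqrt ((hnorm D (a j))\<^sup>2)) \<longlonglongrightarrow> sqrt 0" by (rule tendsto_real_sqrt)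
  then show ?thesis using D.nrm_nonneg[OF mem] by simp
qed

lemma approx_add: "approx a \<xi> \<Longrightarrow> approx b \<eta> \<Longrightarrow> approx (\<lambda>j. a j + b j) (\<xi> + \<eta>)"
  by (auto simp: approx_def intro: D.hcauchy_add tendsto_add)

lemma approx_scaleC: "approx a \<xi> \<Longrightarrow> approx (\<lambda>j. c *\<^sub>C a j) (c *\<^sub>C \<xi>)"
  unfolding approx_def
  by (intro conjI D.hcauchy_scaleC; simp add: scaleC_complex_def scaleC_fun_def tendsto_mult_left)

lemma approx_diff: "approx a \<xi> \<Longrightarrow> approx b \<eta> \<Longrightarrow> approx (\<lambda>j. a j - b j) (\<xi> - \<eta>)"
  by (auto simp: approx_def intro: D.hcauchy_diff tendsto_diff)

lemma approx_const: "approx (\<lambda>_. k t) (k t)"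
  by (auto simp: approx_def intro: D.hcauchy_const)

definition rkhs :: "('x \<Rightarrow> complex) hspace" where
  "rkhs = \<lparr>hcarrier = {\<xi>. \<exists>a. approx a \<xi>},
    hinner = (\<lambda>\<xi> \<eta>. lim (\<lambda>j. hinner D ((SOME a. approx a \<xi>) j) ((SOME b. approx b \<eta>) j)))\<rparr>"

lemma mem_rkhs: "\<xi> \<in> hcarrier rkhs \<longleftrightarrow> (\<exists>a. approx a \<xi>)"
  by (simp add: rkhs_def)

text \<open>Two sequences representing the same function differ by one with pointwise limit 0, which
  is null in norm. Hence the sequences chosen in \<open>rkhs\<close> can be replaced by any
  others.\<close>

lemma approx_inner:
  assumes a: "approx a \<xi>" and b: "approx b \<eta>"
  shows "(\<lambda>j. hinner D (a j) (b j)) \<longlonglongrightarrow> hinner rkhs \<xi> \<eta>"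
proof -
  define a' b' where "a' = (SOME a. approx a \<xi>)" and "b' = (SOME b. approx b \<eta>)"
  have a': "approx a' \<xi>" and b': "approx b' \<eta>"
    unfolding a'_def b'_def by (rule someI[of "\<lambda>a. approx a _", OF a], rule someI[of "\<lambda>a. approx a _", OF b])
  have C: "hcauchy D a" "hcauchy D b" "hcauchy D a'" "hcauchy D b'"
    using a b a' b' by (auto simp: approx_def)
  note mem = C[THEN D.hcauchyD]
  have "(\<lambda>j. hinner D (a' j) (b' j)) \<longlonglongrightarrow> hinner rkhs \<xi> \<eta>"
    using D.hcauchy_inner_convergent[OF C(3,4)]
    by (simp add: rkhs_def convergent_LIMSEQ_iff a'_def b'_def)
  moreover have "(\<lambda>j. hinner D (a j - a' j) (b j)) \<longlonglongrightarrow> 0"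
    using approx_null approx_diff[OF a a'] by (intro D.inner_null_left D.mem mem C) simp
  moreover have "(\<lambda>j. hinner D (a' j) (b j - b' j)) \<longlonglongrightarrow> 0"
    using approx_null approx_diff[OF b b'] by (intro D.inner_null_right D.mem mem C) simp
  ultimately have "(\<lambda>j. hinner D (a' j) (b' j) + hinner D (a j - a' j) (b j) +
      hinner D (a' j) (b j - b' j)) \<longlonglongrightarrow> hinner rkhs \<xi> \<eta> + 0 + 0"
    by (intro tendsto_add)
  then show ?thesis using mem by (simp add: D.inner_simps)
qed

end

sublocale reproducing_kernel \<subseteq> R: inner_space rkhs
proof
  show "complex_vector.subspace (hcarrier rkhs)"
  proof (rule complex_vector.subspaceI)
    have "approx (\<lambda>_. 0) 0"
      unfolding approx_def using D.hcauchy_const[OF D.mem(1)] by simp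
    then show "0 \<in> hcarrier rkhs" by (auto simp: mem_rkhs)
  qed (auto simp: mem_rkhs intro: approx_add approx_scaleC)
  show "hinner rkhs x (y + z) = hinner rkhs x y + hinner rkhs x z"
    if xyz: "x \<in> hcarrier rkhs" "y \<in> hcarrier rkhs" "z \<in> hcarrier rkhs" for x y z
  proof -
    obtain a b c where abc: "approx a x" "approx b y" "approx c z" using xyz by (auto simp: mem_rkhs)
    have mem: "a j \<in> hcarrier D" "b j \<in> hcarrier D" "c j \<in> hcarrier D" for j
      using abc D.hcauchyD unfolding approx_def by blast+
    show ?thesis
    proof (rule LIMSEQ_unique)
      show "(\<lambda>j. hinner D (a j) (b j + c j)) \<longlonglongrightarrow> hinner rkhs x (y + z)"
        by (intro approx_inner approx_add abc)
      show "(\<lambda>j. hinner D (a j) (b j + c j)) \<longlonglongrightarrow> hinner rkhs x y + hinner rkhs x z"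
        unfolding D.inner_add_right[OF mem] by (intro tendsto_add approx_inner abc)
    qed
  qed
  show "hinner rkhs x (c *\<^sub>C y) = c * hinner rkhs x y"
    if xy: "x \<in> hcarrier rkhs" "y \<in> hcarrier rkhs" for x y c
  proof -
    obtain a b where ab: "approx a x" "approx b y" using xy by (auto simp: mem_rkhs)
    have mem: "a j \<in> hcarrier D" "b j \<in> hcarrier D" for j
      using ab D.hcauchyD unfolding approx_def by blast+
    show ?thesis
    proof (rule LIMSEQ_unique)
      show "(\<lambda>j. hinner D (a j) (c *\<^sub>C b j)) \<longlonglongrightarrow> hinner rkhs x (c *\<^sub>C y)"
        by (intro approx_inner approx_scaleC ab)
      show "(\<lambda>j. hinner D (a j) (c *\<^sub>C b j)) \<longlonglongrightarrow> c * hinner rkhs x y"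
        unfolding D.inner_scaleC_right[OF mem] by (intro tendsto_mult_left approx_inner ab)
    qed
  qed
  show "hinner rkhs y x = cnj (hinner rkhs x y)"
    if xy: "x \<in> hcarrier rkhs" "y \<in> hcarrier rkhs" for x y
  proof -
    obtain a b where ab: "approx a x" "approx b y" using xy by (auto simp: mem_rkhs)
    have mem: "a j \<in> hcarrier D" "b j \<in> hcarrier D" for j
      using ab D.hcauchyD unfolding approx_def by blast+
    show ?thesis
    proof (rule LIMSEQ_unique)
      show "(\<lambda>j. hinner D (b j) (a j)) \<longlonglongrightarrow> hinner rkhs y x"
        by (intro approx_inner ab)
      show "(\<lambda>j. hinner D (b j) (a j)) \<longlonglongrightarrow> cnj (hinner rkhs x y)"
        unfolding D.inner_commute[OF mem] by (intro tendsto_cnj approx_inner ab)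
    qed
  qed
  fix x assume "x \<in> hcarrier rkhs"
  then obtain a where a: "approx a x" by (auto simp: mem_rkhs)
  have mem: "a j \<in> hcarrier D" for j
    using a D.hcauchyD unfolding approx_def by blast
  have lim: "(\<lambda>j. complex_of_real ((hnorm D (a j))\<^sup>2)) \<longlonglongrightarrow> hinner rkhs x x"
    using approx_inner[OF a a] unfolding D.inner_self[OF mem] .
  show "hinner rkhs x x \<in> \<real>\<^sub>\<ge>\<^sub>0"
  proof -
    have "(\<lambda>j. (hnorm D (a j))\<^sup>2) \<longlonglongrightarrow> Re (hinner rkhs x x)"
      using tendsto_Re[OF lim] by simp
    then have "0 \<le> Re (hinner rkhs x x)"
      by (rule LIMSEQ_le_const) auto
    moreover have "(\<lambda>j. 0) \<longlonglongrightarrow> Im (hinner rkhs x x)"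
      using tendsto_Im[OF lim] by simp
    ultimately show ?thesis by (simp add: complex_nonneg_Reals_iff LIMSEQ_const_iff)
  qed
  show "x = 0" if "hinner rkhs x x = 0"
  proof
    fix s
    have "(\<lambda>j. (hnorm D (a j))\<^sup>2) \<longlonglongrightarrow> 0"
      using tendsto_Re[OF lim] that by simp
    from tendsto_real_sqrt[OF this] have "(\<lambda>j. hnorm D (a j)) \<longlonglongrightarrow> 0"
      using D.nrm_nonneg[OF mem] by simp
    then have "(\<lambda>j. hnorm D (k s) * hnorm D (a j)) \<longlonglongrightarrow> 0"
      by (rule tendsto_mult_right_zero)
    \<comment> \<open>Convergence to 0 in the norm of \<open>D\<close> forces convergence to 0 at
      every point, so the pointwise limit \<open>x\<close> is zero.\<close>
    moreover have "cmod (a j s) \<le> hnorm D (k s) * hnorm D (a j)" for j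
      using D.cauchy_schwarz[of "k s" "a j"] mem[of j] by (simp add: inner_D)
    ultimately have "(\<lambda>j. a j s) \<longlonglongrightarrow> 0"
      by (rule null_comparison)
    moreover have "(\<lambda>j. a j s) \<longlonglongrightarrow> x s" using a by (simp add: approx_def)
    ultimately show "x s = 0 s" using LIMSEQ_unique by fastforce
  qed
qed

context reproducing_kernel
begin

lemma k_mem: "k t \<in> hcarrier rkhs"
  using approx_const mem_rkhs by blast

lemma inner_rkhs: "\<xi> \<in> hcarrier D \<Longrightarrow> \<eta> \<in> hcarrier D \<Longrightarrow> hinner rkhs \<xi> \<eta> = hinner D \<xi> \<eta>"
  using approx_inner[OF approx_const approx_const] by (auto simp: LIMSEQ_const_iff)

lemma D_subset: "d \<in> hcarrier D \<Longrightarrow> d \<in> hcarrier rkhs"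
  using k_mem by auto

lemma norm_rkhs: "\<xi> \<in> hcarrier D \<Longrightarrow> hnorm rkhs \<xi> = hnorm D \<xi>"
  by (simp add: hnorm_def inner_rkhs del: carrier_D)

lemma reproducing:
  assumes "\<xi> \<in> hcarrier rkhs" shows "hinner rkhs (k s) \<xi> = \<xi> s"
proof -
  obtain a where a: "approx a \<xi>" using assms by (auto simp: mem_rkhs)
  then have "a j \<in> hcarrier D" for j using D.hcauchyD unfolding approx_def by blast
  then have "hinner D (k s) (a j) = a j s" for j by (simp add: inner_D)
  then have "(\<lambda>j. a j s) \<longlonglongrightarrow> hinner rkhs (k s) \<xi>" using approx_inner[OF approx_const[of s] a] by simp
  then show ?thesis using a LIMSEQ_unique by (auto simp: approx_def)
qed

lemma norm_limit:
  assumes "approx a \<xi>"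
  shows "(\<lambda>j. hnorm D (a j)) \<longlonglongrightarrow> hnorm rkhs \<xi>"
  unfolding hnorm_def by (intro tendsto_real_sqrt tendsto_Re approx_inner assms)

lemma approx_hconv:
  assumes a: "approx a \<xi>"
  shows "hconv rkhs a \<xi>"
proof -
  have C: "hcauchy D a" using a by (simp add: approx_def)
  have mem: "a j \<in> hcarrier D" for j using D.hcauchyD C by blast
  have xi: "\<xi> \<in> hcarrier rkhs" using a mem_rkhs by blast
  \<comment> \<open>Here \<open>j\<close> is fixed and \<open>i\<close> tends to infinity: the
    sequence of the \<open>a j - a i\<close> represents \<open>a j - \<xi>\<close>. A Cauchy
    estimate thus becomes an estimate of the distance to the limit.\<close>
  have lim: "(\<lambda>i. hnorm D (a j - a i)) \<longlonglongrightarrow> hnorm rkhs (a j - \<xi>)" for j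
  proof (intro norm_limit approx_diff a)
    show "approx (\<lambda>_. a j) (a j)" using mem[of j] approx_const by auto
  qed
  have "(\<lambda>j. hnorm rkhs (a j - \<xi>)) \<longlonglongrightarrow> 0"
  proof (rule LIMSEQ_I)
    fix e :: real assume "0 < e"
    then have e: "0 < e / 2" by simp
    obtain N where N: "\<And>i j. N \<le> i \<Longrightarrow> N \<le> j \<Longrightarrow> hnorm D (a i - a j) < e / 2"
      using D.hcauchyE[OF C e] by blast
    have "norm (hnorm rkhs (a j - \<xi>) - 0) < e" if "N \<le> j" for j
    proof -
      have "hnorm rkhs (a j - \<xi>) \<le> e / 2"
        by (rule LIMSEQ_le_const2[OF lim]) (use N that less_imp_le in blast)
      moreover have "0 \<le> hnorm rkhs (a j - \<xi>)"
        by (intro R.nrm_nonneg R.mem D_subset mem xi)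
      ultimately show ?thesis using \<open>0 < e\<close> by simp
    qed
    then show "\<exists>N. \<forall>j\<ge>N. norm (hnorm rkhs (a j - \<xi>) - 0) < e" by blast
  qed
  then show ?thesis unfolding hconv_def using mem D_subset xi by blast
qed

lemma dense_sections: "R.dense (range k)"
  unfolding R.dense_def
proof (intro conjI ballI)
  show "range k \<subseteq> hcarrier rkhs" using k_mem by (rule image_subsetI)
  fix \<xi> assume "\<xi> \<in> hcarrier rkhs"
  then obtain a where a: "approx a \<xi>" unfolding mem_rkhs ..
  then have "range a \<subseteq> range k" by (simp add: approx_def hcauchy_def)
  with approx_hconv[OF a] show "\<exists>a. range a \<subseteq> range k \<and> hconv rkhs a \<xi>" by (intro exI conjI)
qed

end

sublocale reproducing_kernel \<subseteq> R: hilbert rkhs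
proof
  fix \<xi> assume \<xi>: "hcauchy rkhs \<xi>"
  then have \<xi>_mem: "\<xi> j \<in> hcarrier rkhs" for j using R.hcauchyD by blast
  \<comment> \<open>Replace each term by an element of \<open>D\<close> at distance less than
    \<open>inverse (real (Suc j))\<close>. The new sequence is Cauchy in \<open>D\<close>, hence
    represents a function of the space, and the old one has the same limit.\<close>
  have "\<exists>d. d \<in> hcarrier D \<and> hnorm rkhs (d - \<xi> j) < inverse (real (Suc j))" for j
  proof -
    obtain a where a: "range a \<subseteq> hcarrier D" "hconv rkhs a (\<xi> j)"
      using dense_sections \<xi>_mem[of j] unfolding R.dense_def carrier_D by blast
    have "\<forall>\<^sub>F i in sequentially. hnorm rkhs (a i - \<xi> j) < inverse (real (Suc j))"
      using a(2) by (intro order_tendstoD[where y = 0]) (simp_all add: hconv_def)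
    then obtain i where "hnorm rkhs (a i - \<xi> j) < inverse (real (Suc j))"
      by (auto simp: eventually_sequentially)
    then show ?thesis using a(1) by blast
  qed
  then obtain d where d: "\<And>j. d j \<in> hcarrier D"
    "\<And>j. hnorm rkhs (d j - \<xi> j) < inverse (real (Suc j))" by metis
  have d_mem: "d j \<in> hcarrier rkhs" for j using d D_subset by blast
  have "norm (hnorm rkhs (d j - \<xi> j)) \<le> inverse (real (Suc j))" for j
    using d(2)[of j] R.nrm_nonneg[OF R.mem(4)[OF d_mem \<xi>_mem], of j j] by simp
  then have null: "(\<lambda>j. hnorm rkhs (d j - \<xi> j)) \<longlonglongrightarrow> 0"
    by (rule null_comparison[OF LIMSEQ_inverse_real_of_nat])
  have C: "hcauchy D d"
  proof (rule D.hcauchyI)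
    fix e :: real assume "0 < e"
    then have e: "0 < e / 3" by simp
    obtain N where N: "\<And>i j. N \<le> i \<Longrightarrow> N \<le> j \<Longrightarrow> hnorm rkhs (\<xi> i - \<xi> j) < e / 3"
      using R.hcauchyE[OF \<xi> e] by blast
    obtain N' where N': "\<And>j. N' \<le> j \<Longrightarrow> \<bar>hnorm rkhs (d j - \<xi> j)\<bar> < e / 3"
      using LIMSEQ_D[OF null e] by auto
    have "hnorm D (d i - d j) < e" if "max N N' \<le> i" "max N N' \<le> j" for i j
    proof -
      have "hnorm D (d i - d j) = hnorm rkhs (d i - d j)"
        by (intro norm_rkhs[symmetric] D.mem d)
      moreover have "hnorm rkhs (d i - d j) \<le> hnorm rkhs (d i - \<xi> i) + hnorm rkhs (\<xi> i - d j)"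
        by (intro R.triangle_diff d_mem \<xi>_mem)
      moreover have "hnorm rkhs (\<xi> i - d j) \<le> hnorm rkhs (\<xi> i - \<xi> j) + hnorm rkhs (\<xi> j - d j)"
        by (intro R.triangle_diff d_mem \<xi>_mem)
      moreover have "hnorm rkhs (\<xi> j - d j) = hnorm rkhs (d j - \<xi> j)"
        by (intro R.nrm_minus_commute d_mem \<xi>_mem)
      moreover have "N \<le> i" "N \<le> j" "N' \<le> i" "N' \<le> j" using that by simp_all
      ultimately show ?thesis using N[of i j] N'[of i] N'[of j] by linarith
    qed
    then show "\<exists>N. \<forall>i j. N \<le> i \<longrightarrow> N \<le> j \<longrightarrow> hnorm D (d i - d j) < e" by blast
  qed (rule d)
  have "convergent (\<lambda>j. d j s)" for s
    using D.hcauchy_inner_convergent[OF D.hcauchy_const C, of "k s"] d by (simp add: inner_D)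
  then have ap: "approx d (\<lambda>s. lim (\<lambda>j. d j s))"
    using C by (simp add: approx_def convergent_LIMSEQ_iff)
  define \<eta> where "\<eta> = (\<lambda>s. lim (\<lambda>j. d j s))"
  have conv: "hconv rkhs d \<eta>" unfolding \<eta>_def by (rule approx_hconv[OF ap])
  then have \<eta>: "\<eta> \<in> hcarrier rkhs" by (simp add: hconv_def)
  have le: "hnorm rkhs (\<xi> j - \<eta>) \<le> hnorm rkhs (d j - \<xi> j) + hnorm rkhs (d j - \<eta>)" for j
    using R.triangle_diff[OF \<xi>_mem d_mem \<eta>, of j j] R.nrm_minus_commute[OF \<xi>_mem d_mem, of j j]
    by simp
  have nn: "0 \<le> hnorm rkhs (\<xi> j - \<eta>)" for j by (intro R.nrm_nonneg R.mem \<xi>_mem \<eta>)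
  have "(\<lambda>j. hnorm rkhs (d j - \<xi> j) + hnorm rkhs (d j - \<eta>)) \<longlonglongrightarrow> 0 + 0"
    using conv by (intro tendsto_add null) (simp add: hconv_def)
  then have "(\<lambda>j. hnorm rkhs (d j - \<xi> j) + hnorm rkhs (d j - \<eta>)) \<longlonglongrightarrow> 0" by simp
  moreover have "norm (hnorm rkhs (\<xi> j - \<eta>)) \<le> hnorm rkhs (d j - \<xi> j) + hnorm rkhs (d j - \<eta>)" for j
    using le[of j] nn[of j] by simp
  ultimately have "(\<lambda>j. hnorm rkhs (\<xi> j - \<eta>)) \<longlonglongrightarrow> 0" by (rule null_comparison)
  then have "hconv rkhs \<xi> \<eta>" unfolding hconv_def using \<xi>_mem \<eta> by blast
  then show "\<exists>x. hconv rkhs \<xi> x" by blast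
qed

text \<open>\<open>\<sigma>\<close> is adjoint to \<open>\<tau>\<close> with respect to the kernel,
  so composition with \<open>\<tau>\<close> sends the section at \<open>t\<close> to the section at
  \<open>\<sigma> t\<close>. As all elements of \<open>D\<close> are sections, a bound on the
  diagonal already bounds the operator.\<close>

locale kernel_map = reproducing_kernel K for K :: "'x \<Rightarrow> 'x \<Rightarrow> complex" +
  fixes \<tau> \<sigma> :: "'x \<Rightarrow> 'x" and C :: real
  assumes kernel_adjoint: "K (\<tau> s) t = K s (\<sigma> t)"
    and kernel_bound: "Re (K (\<sigma> t) (\<sigma> t)) \<le> C * Re (K t t)"
begin

lemma section_comp: "k t \<circ> \<tau> = k (\<sigma> t)"
  by (simp add: k_def fun_eq_iff kernel_adjoint)

lemma comp_D: "d \<in> hcarrier D \<Longrightarrow> d \<circ> \<tau> \<in> hcarrier D"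
  by (auto simp: section_comp)

lemma norm_comp_D: "d \<in> hcarrier D \<Longrightarrow> hnorm D (d \<circ> \<tau>) \<le> sqrt C * hnorm D d"
  using kernel_bound
  by (auto simp: section_comp hnorm_def inner_kk real_sqrt_mult[symmetric])

lemma approx_comp:
  assumes a: "approx a \<xi>"
  shows "approx (\<lambda>j. a j \<circ> \<tau>) (\<xi> \<circ> \<tau>)"
proof -
  have Ca: "hcauchy D a" using a by (simp add: approx_def)
  have mem: "a j \<in> hcarrier D" for j using D.hcauchyD Ca by blast
  have "hcauchy D (\<lambda>j. a j \<circ> \<tau>)"
  proof (rule D.hcauchyI)
    show "a j \<circ> \<tau> \<in> hcarrier D" for j using comp_D mem by blast
    fix e :: real assume "0 < e"
    then have e: "0 < e / (\<bar>sqrt C\<bar> + 1)" by (simp add: add_nonneg_pos)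
    obtain N where N: "\<And>i j. N \<le> i \<Longrightarrow> N \<le> j \<Longrightarrow> hnorm D (a i - a j) < e / (\<bar>sqrt C\<bar> + 1)"
      using D.hcauchyE[OF Ca e] by blast
    have "hnorm D ((a i \<circ> \<tau>) - (a j \<circ> \<tau>)) < e" if "N \<le> i" "N \<le> j" for i j
    proof -
      have d: "a i - a j \<in> hcarrier D" by (intro D.mem mem)
      have "(a i \<circ> \<tau>) - (a j \<circ> \<tau>) = (a i - a j) \<circ> \<tau>" by (simp add: fun_eq_iff)
      then have "hnorm D ((a i \<circ> \<tau>) - (a j \<circ> \<tau>)) \<le> sqrt C * hnorm D (a i - a j)"
        using norm_comp_D[OF d] by simp
      also have "\<dots> \<le> (\<bar>sqrt C\<bar> + 1) * hnorm D (a i - a j)"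
        by (intro mult_right_mono D.nrm_nonneg d) simp
      also have "\<dots> < e"
        using N[OF that] by (simp add: pos_less_divide_eq add_nonneg_pos mult.commute)
      finally show ?thesis .
    qed
    then show "\<exists>N. \<forall>i j. N \<le> i \<longrightarrow> N \<le> j \<longrightarrow> hnorm D ((a i \<circ> \<tau>) - (a j \<circ> \<tau>)) < e" by blast
  qed
  then show ?thesis using a by (auto simp: approx_def)
qed

lemma comp_mem: "\<xi> \<in> hcarrier rkhs \<Longrightarrow> \<xi> \<circ> \<tau> \<in> hcarrier rkhs"
  using approx_comp unfolding mem_rkhs by blast

lemma norm_comp:
  assumes "\<xi> \<in> hcarrier rkhs" shows "hnorm rkhs (\<xi> \<circ> \<tau>) \<le> sqrt C * hnorm rkhs \<xi>"
proof -
  obtain a where a: "approx a \<xi>" using assms mem_rkhs by blast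
  have mem: "a j \<in> hcarrier D" for j using a D.hcauchyD unfolding approx_def by blast
  show ?thesis
  proof (rule LIMSEQ_le)
    show "(\<lambda>j. hnorm D (a j \<circ> \<tau>)) \<longlonglongrightarrow> hnorm rkhs (\<xi> \<circ> \<tau>)"
      by (intro norm_limit approx_comp a)
    show "(\<lambda>j. sqrt C * hnorm D (a j)) \<longlonglongrightarrow> sqrt C * hnorm rkhs \<xi>"
      by (intro tendsto_mult_left norm_limit a)
  qed (use norm_comp_D mem in blast)
qed

lemma bounded_comp: "bounded_op rkhs rkhs (\<lambda>\<xi>. \<xi> \<circ> \<tau>)"
  unfolding bounded_op_def using comp_mem norm_comp
  by (auto simp: fun_eq_iff scaleC_fun_def)

end

text \<open>On sections both sides are values of the kernel related by
  \<open>kernel_adjoint\<close>; the general case follows by passing to limits.\<close>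

lemma (in reproducing_kernel) inner_comp:
  assumes "kernel_map K \<tau> \<sigma> C" "kernel_map K \<sigma> \<tau> C'"
    and \<xi>: "\<xi> \<in> hcarrier rkhs" and \<eta>: "\<eta> \<in> hcarrier rkhs"
  shows "hinner rkhs (\<xi> \<circ> \<tau>) \<eta> = hinner rkhs \<xi> (\<eta> \<circ> \<sigma>)"
proof -
  interpret T: kernel_map K \<tau> \<sigma> C by fact
  interpret S: kernel_map K \<sigma> \<tau> C' by fact
  obtain a b where a: "approx a \<xi>" and b: "approx b \<eta>" using \<xi> \<eta> unfolding mem_rkhs by blast
  have mem: "a j \<in> range k" "b j \<in> range k" for j
    using a b unfolding approx_def hcauchy_def carrier_D by blast+
  have "hinner D (a j \<circ> \<tau>) (b j) = hinner D (a j) (b j \<circ> \<sigma>)" for j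
    using mem[of j] by (auto simp: T.section_comp S.section_comp inner_kk S.kernel_adjoint)
  then have "(\<lambda>j. hinner D (a j \<circ> \<tau>) (b j)) \<longlonglongrightarrow> hinner rkhs \<xi> (\<eta> \<circ> \<sigma>)"
    using approx_inner[OF a S.approx_comp[OF b]] by simp
  moreover have "(\<lambda>j. hinner D (a j \<circ> \<tau>) (b j)) \<longlonglongrightarrow> hinner rkhs (\<xi> \<circ> \<tau>) \<eta>"
    by (rule approx_inner[OF T.approx_comp[OF a] b])
  ultimately show ?thesis using LIMSEQ_unique by blast
qed

section \<open>Endomorphisms and states of C*-algebras\<close>

instance unital_cstar_algebra \<subseteq> banach ..

lemma star_one [simp]: "star (1::'a::unital_cstar_algebra) = 1"
  by (metis mult.left_neutral mult.right_neutral star_mult star_star)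

lemma norm_star: "norm (star x) = norm (x::'a::unital_cstar_algebra)"
proof -
  have le: "norm y \<le> norm (star y)" for y :: 'a
  proof (cases "y = 0")
    case False
    have "norm y * norm y \<le> norm (star y) * norm y"
      using norm_mult_ineq[of "star y" y] by (simp add: cstar_identity power2_eq_square)
    then show ?thesis using False by simp
  qed simp
  show ?thesis using le[of x] le[of "star x"] by (simp add: star_star)
qed

lemma bounded_linear_star: "bounded_linear (star :: 'a::unital_cstar_algebra \<Rightarrow> 'a)"
  by (rule bounded_linear_intro[of _ 1])
    (simp_all add: star_add scaleR_eq_scaleC star_scaleC norm_star)

lemma star_power: "star (x ^ n) = star x ^ n" for x :: "'a::unital_cstar_algebra"
  by (induction n) (simp_all add: star_mult power_commutes)

text \<open>\<open>b\<close> is the binomial series of \<open>(1 - a)^(1/2)\<close>. By Vandermonde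
  the coefficients of its square are \<open>(1 gchoose n) * (-1) ^ n\<close>, which vanish from
  \<open>n = 2\<close> on. Real coefficients keep \<open>b\<close> selfadjoint.\<close>

lemma selfadjoint_sqrt:
  fixes a :: "'a::unital_cstar_algebra"
  assumes sa: "star a = a" and a: "norm a < 1"
  obtains b where "star b = b" "b * b = 1 - a"
proof -
  define c :: "nat \<Rightarrow> real" where "c n = (1 / 2 gchoose n) * (-1) ^ n" for n
  define t where "t n = c n *\<^sub>R a ^ n" for n
  \<comment> \<open>A point strictly between \<open>norm a\<close> and 1: convergence of the scalar
    series at \<open>r\<close> gives absolute convergence at \<open>norm a\<close>.\<close>
  define r where "r = (1 + norm a) / 2"
  have r: "norm a < r" "r < 1" "0 < r" using a by (auto simp: r_def add_pos_nonneg)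
  have "summable (\<lambda>n. (1 / 2 gchoose n) * r ^ n)"
    using gen_binomial_real[of r "1 / 2"] r by (auto simp: sums_iff)
  then have "summable (\<lambda>n. norm ((1 / 2 gchoose n) * norm a ^ n))"
    by (rule powser_insidea) (use r in simp)
  then have t_abs: "summable (\<lambda>n. norm (t n))"
  proof (rule summable_comparison_test')
    show "norm (norm (t n)) \<le> norm ((1 / 2 gchoose n) * norm a ^ n)" for n
      unfolding t_def c_def
      by (simp add: abs_mult norm_power_ineq mult_left_mono power_abs)
  qed
  define b where "b = (\<Sum>n. t n)"
  have "star b = (\<Sum>n. star (t n))"
    unfolding b_def by (rule bounded_linear.suminf[OF bounded_linear_star summable_norm_cancel[OF t_abs]])
  also have "\<dots> = b"
    by (simp add: b_def t_def scaleR_eq_scaleC star_scaleC star_power sa)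
  finally have "star b = b" .
  moreover have "b * b = 1 - a"
  proof -
    have coeff: "(\<Sum>i\<le>n. t i * t (n - i)) = ((1 gchoose n) * (-1) ^ n) *\<^sub>R a ^ n" for n
    proof -
      have "(\<Sum>i\<le>n. t i * t (n - i)) = (\<Sum>i\<le>n. (c i * c (n - i)) *\<^sub>R a ^ n)"
        by (intro sum.cong refl) (simp add: t_def flip: power_add)
      also have "\<dots> = (\<Sum>i\<le>n. c i * c (n - i)) *\<^sub>R a ^ n"
        by (rule scaleR_left.sum[symmetric])
      also have "(\<Sum>i\<le>n. c i * c (n - i)) = (\<Sum>i\<le>n. (1 / 2 gchoose i) * (1 / 2 gchoose (n - i))) * (-1) ^ n"
        unfolding sum_distrib_right
      proof (intro sum.cong refl)
        fix i assume "i \<in> {..n}"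
        then have "(-1::real) ^ n = (-1) ^ i * (-1) ^ (n - i)" by (simp flip: power_add)
        then show "c i * c (n - i) = (1 / 2 gchoose i) * (1 / 2 gchoose (n - i)) * (-1) ^ n"
          by (simp add: c_def)
      qed
      also have "(\<Sum>i\<le>n. (1 / 2 gchoose i) * (1 / 2 gchoose (n - i))) = (1::real) gchoose n"
        using gbinomial_Vandermonde[where a = "1 / 2 :: real" and b = "1 / 2" and n = n] by (simp add: atLeast0AtMost)
      finally show ?thesis .
    qed
    have gc: "(1::real) gchoose n = real (1 choose n)" for n
      using binomial_gbinomial[of 1 n, where ?'a = real] by simp
    have "b * b = (\<Sum>n. \<Sum>i\<le>n. t i * t (n - i))"
      unfolding b_def by (rule Cauchy_product[OF t_abs t_abs])
    also have "\<dots> = (\<Sum>n\<in>{0, 1}. ((1 gchoose n) * (-1) ^ n) *\<^sub>R a ^ n)"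
      unfolding coeff gc by (rule suminf_finite) (auto simp: binomial_eq_0)
    also have "\<dots> = 1 - a" by simp
    finally show ?thesis .
  qed
  ultimately show thesis by (rule that)
qed

lemma star_diff: "star (x - y) = star x - star (y::'a::unital_cstar_algebra)"
  using star_add[of "x - y" y] by (simp add: algebra_simps)

locale star_endo =
  fixes \<alpha> :: "'a::unital_cstar_algebra \<Rightarrow> 'a"
  assumes hom: "star_hom \<alpha>"
begin

lemma add: "\<alpha> (f + g) = \<alpha> f + \<alpha> g"
  and scaleC: "\<alpha> (c *\<^sub>C f) = c *\<^sub>C \<alpha> f"
  and mult: "\<alpha> (f * g) = \<alpha> f * \<alpha> g"
  and star: "\<alpha> (star f) = star (\<alpha> f)"
  using hom unfolding star_hom_def by blast+

lemma diff: "\<alpha> (f - g) = \<alpha> f - \<alpha> g"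
  using add[of "f - g" g] by (simp add: algebra_simps)

end

lemma star_endo_funpow: "star_endo \<alpha> \<Longrightarrow> star_endo (\<alpha> ^^ n)"
  by (induction n) (simp_all add: star_endo_def star_hom_def)

locale state =
  fixes \<mu> :: "'a::unital_cstar_algebra \<Rightarrow> complex"
  assumes state: "cstar_state \<mu>"
begin

lemma mu_add: "\<mu> (f + g) = \<mu> f + \<mu> g"
  and mu_scaleC: "\<mu> (c *\<^sub>C f) = c * \<mu> f"
  and mu_nonneg: "\<mu> (star f * f) \<in> \<real>\<^sub>\<ge>\<^sub>0"
  using state unfolding cstar_state_def by blast+

lemma mu_diff: "\<mu> (f - g) = \<mu> f - \<mu> g"
  using mu_add[of "f - g" g] by (simp add: algebra_simps)

lemma mu_zero [simp]: "\<mu> 0 = 0"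
  using mu_add[of 0 0] by simp

lemma mu_Re: "0 \<le> Re (\<mu> (star f * f))" and mu_Im: "Im (\<mu> (star f * f)) = 0"
  using mu_nonneg[of f] by (auto simp: complex_nonneg_Reals_iff)

text \<open>Polarization: \<mu> is real on the squares of \<open>f + g\<close> and
  \<open>f + \<i> *\<^sub>C g\<close>. The first compares the imaginary parts, the second the real
  parts.\<close>

lemma mu_hermitian: "\<mu> (star g * f) = cnj (\<mu> (star f * g))"
proof -
  have "star (f + g) * (f + g) = star f * f + star f * g + (star g * f + star g * g)"
    by (simp add: star_add algebra_simps)
  then have "Im (\<mu> (star f * g)) + Im (\<mu> (star g * f)) = 0"
    using mu_Im[of "f + g"] mu_Im[of f] mu_Im[of g] by (simp add: mu_add)
  moreover
  have "star (f + \<i> *\<^sub>C g) * (f + \<i> *\<^sub>C g) =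
      star f * f + \<i> *\<^sub>C (star f * g) + ((- \<i>) *\<^sub>C (star g * f) + (- \<i> * \<i>) *\<^sub>C (star g * g))"
    by (simp add: star_add star_scaleC distrib_left distrib_right mult_scaleC_left
        mult_scaleC_right scaleC_add_right scaleC_scaleC del: complex_vector.scale_minus_left)
  then have "Re (\<mu> (star f * g)) - Re (\<mu> (star g * f)) = 0"
    using mu_Im[of "f + \<i> *\<^sub>C g"] mu_Im[of f] mu_Im[of g]
    by (simp add: mu_add mu_scaleC del: complex_vector.scale_minus_left)
  ultimately show ?thesis by (simp add: complex_eq_iff)
qed

text \<open>
  Applying \<open>\<alpha>\<close> to the square root of \<open>1 - h\<^sup>* h\<close> gives a bound that is uniform in \<open>\<alpha>\<close> without
  using that \<open>\<alpha>\<close> is contractive.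
\<close>

lemma hom_bound:
  assumes \<alpha>: "star_endo \<alpha>"
  shows "Re (\<mu> (star (\<alpha> h * f) * (\<alpha> h * f))) \<le> (norm h + 1)\<^sup>2 * Re (\<mu> (star f * f))"
proof -
  interpret star_endo \<alpha> by fact
  \<comment> \<open>The summand 1 makes \<open>norm h'\<close> strictly less than 1, as the square
    root requires, and allows the division for \<open>h = 0\<close>.\<close>
  define r where "r = norm h + 1"
  have r: "0 < r" by (simp add: r_def add_nonneg_pos)
  define h' where "h' = complex_of_real (1 / r) *\<^sub>C h"
  have h: "h = complex_of_real r *\<^sub>C h'"
    using r by (simp add: h'_def scaleC_scaleC scaleC_one flip: of_real_mult)
  have "norm h' < 1" using r by (simp add: h'_def norm_scaleC norm_divide r_def)
  then have "norm (star h' * h') < 1" by (simp add: cstar_identity power_less_one_iff)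
  then obtain b where b: "star b = b" "b * b = 1 - star h' * h'"
    using selfadjoint_sqrt[of "star h' * h'"] by (auto simp: star_mult star_star)
  \<comment> \<open>A projection that may differ from 1, as \<alpha> need not be unital. The gap
    between \<open>star f * p * f\<close> and \<open>star f * f\<close> is closed by positivity at
    \<open>(1 - p) * f\<close>.\<close>
  define p where "p = \<alpha> 1"
  have p: "p * p = p" "star p = p" using mult[of 1 1] star[of 1] by (simp_all add: p_def)
  have "\<alpha> b * \<alpha> b = p - star (\<alpha> h') * \<alpha> h'"
    by (simp add: p_def b diff flip: mult star)
  moreover have "star (\<alpha> b) = \<alpha> b" using star[of b] b by simp
  ultimately have "star (\<alpha> b * f) * (\<alpha> b * f) = star f * p * f - star (\<alpha> h' * f) * (\<alpha> h' * f)"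
    by (metis (no_types, lifting) left_diff_distrib mult.assoc right_diff_distrib star_mult)
  then have 1: "Re (\<mu> (star (\<alpha> h' * f) * (\<alpha> h' * f))) \<le> Re (\<mu> (star f * p * f))"
    using mu_Re[of "\<alpha> b * f"] by (simp add: mu_diff)
  have "star ((1 - p) * f) * ((1 - p) * f) = star f * ((1 - p) * (1 - p)) * f"
    by (simp add: star_mult star_diff p mult.assoc)
  also have "(1 - p) * (1 - p) = 1 - p" by (simp add: algebra_simps p)
  finally have "star ((1 - p) * f) * ((1 - p) * f) = star f * f - star f * p * f"
    by (simp add: algebra_simps)
  then have 2: "Re (\<mu> (star f * p * f)) \<le> Re (\<mu> (star f * f))"
    using mu_Re[of "(1 - p) * f"] by (simp add: mu_diff)
  have "star (\<alpha> h * f) * (\<alpha> h * f) = complex_of_real (r\<^sup>2) *\<^sub>C (star (\<alpha> h' * f) * (\<alpha> h' * f))"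
    by (subst (1 2) h) (simp add: scaleC mult_scaleC_left mult_scaleC_right star_scaleC
        scaleC_scaleC power2_eq_square)
  then have "Re (\<mu> (star (\<alpha> h * f) * (\<alpha> h * f))) = r\<^sup>2 * Re (\<mu> (star (\<alpha> h' * f) * (\<alpha> h' * f)))"
    by (simp add: mu_scaleC flip: of_real_power)
  also have "\<dots> \<le> r\<^sup>2 * Re (\<mu> (star f * f))"
    using 1 2 by (intro mult_left_mono) auto
  finally show ?thesis by (simp add: r_def)
qed

end

section \<open>The covariant quadruple\<close>

locale covariant_data = star_endo \<alpha> + state \<mu>
  for \<alpha> :: "'a::unital_cstar_algebra \<Rightarrow> 'a" and \<mu> :: "'a \<Rightarrow> complex" +
  fixes m\<^sub>0 :: 'a
  assumes invariant: "\<mu> (star m\<^sub>0 * \<alpha> f * m\<^sub>0) = \<mu> f"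
begin

definition V :: "'a \<Rightarrow> 'a" where
  "V f = \<alpha> f * m\<^sub>0"

text \<open>The invariance hypothesis at \<open>star f * g\<close>: \<open>V\<close> is an isometry
  for the semi-inner product of the GNS construction.\<close>

lemma V_isometric: "\<mu> (star (V f) * V g) = \<mu> (star f * g)"
  using invariant[of "star f * g"] by (simp add: V_def star_mult mult star mult.assoc)

lemma Vn_isometric: "\<mu> (star ((V ^^ n) f) * (V ^^ n) g) = \<mu> (star f * g)"
  by (induction n) (simp_all add: V_isometric)

lemma Vn_add: "(V ^^ n) (f + g) = (V ^^ n) f + (V ^^ n) g"
  by (induction n) (simp_all add: V_def add distrib_right)

lemma Vn_scaleC: "(V ^^ n) (c *\<^sub>C f) = c *\<^sub>C (V ^^ n) f"
  by (induction n) (simp_all add: V_def scaleC mult_scaleC_left)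

lemma Vn_zero [simp]: "(V ^^ n) 0 = 0"
  using Vn_add[of n 0 0] by simp

lemma Vn_mult: "(V ^^ n) (g * f) = (\<alpha> ^^ n) g * (V ^^ n) f"
  by (induction n) (simp_all add: V_def mult mult.assoc)

lemma Vn_Vm: "(V ^^ n) ((V ^^ m) f) = (V ^^ (n + m)) f"
  by (simp add: funpow_add)

lemma star_endo_n: "star_endo (\<alpha> ^^ n)"
  by (rule star_endo_funpow) unfold_locales

lemmas n_add = star_endo.add[OF star_endo_n]
  and n_scaleC = star_endo.scaleC[OF star_endo_n]
  and n_mult = star_endo.mult[OF star_endo_n]
  and n_star = star_endo.star[OF star_endo_n]

text \<open>The Gram matrix of the vectors \<open>U\<^sup>-\<^sup>n \<pi>(f) \<phi>\<close>, computed by applying \<open>U\<close> to the power \<open>m + n\<close>.\<close>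

definition gram :: "nat \<times> 'a \<Rightarrow> nat \<times> 'a \<Rightarrow> complex" where
  "gram s t = \<mu> (star ((V ^^ fst t) (snd s)) * (V ^^ fst s) (snd t))"

lemma gram_diag: "gram (n, f) (n, f) = \<mu> (star f * f)"
  by (simp add: gram_def Vn_isometric)

lemma gram_hermitian: "gram t s = cnj (gram s t)"
  by (simp add: gram_def mu_hermitian[of "(V ^^ fst t) (snd s)"])

text \<open>The kernel cannot distinguish an index from its rewriting m levels deeper. Two indices
  can thus be brought to one level, where sections add; this is \<open>gram_sum\<close>.\<close>

lemma gram_raise: "gram s (n + m, (V ^^ m) f) = gram s (n, f)"
  using Vn_isometric[of m "(V ^^ n) (snd s)" "(V ^^ fst s) f"]
  by (simp add: gram_def Vn_Vm add.commute)

lemma gram_add: "gram s (n, f + g) = gram s (n, f) + gram s (n, g)"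
  by (simp add: gram_def Vn_add distrib_left mu_add)

lemma gram_scaleC: "gram s (n, c *\<^sub>C f) = c * gram s (n, f)"
  by (simp add: gram_def Vn_scaleC mult_scaleC_right mu_scaleC)

lemma gram_sum: "gram s (n, f) + gram s (m, g) = gram s (n + m, (V ^^ m) f + (V ^^ n) g)"
  using gram_raise[of s n m f] gram_raise[of s m n g] by (simp add: gram_add add.commute)

sublocale reproducing_kernel gram
proof
  show "complex_vector.subspace (range (\<lambda>t s. gram s t))"
  proof (rule complex_vector.subspaceI)
    have "(\<lambda>s. gram s (0, 0)) = 0" by (simp add: gram_def fun_eq_iff)
    then show "0 \<in> range (\<lambda>t s. gram s t)" by (metis rangeI)
  next
    fix x y assume "x \<in> range (\<lambda>t s. gram s t)" "y \<in> range (\<lambda>t s. gram s t)"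
    then obtain n f m g where "x = (\<lambda>s. gram s (n, f))" "y = (\<lambda>s. gram s (m, g))" by auto
    then have "x + y = (\<lambda>s. gram s (n + m, (V ^^ m) f + (V ^^ n) g))"
      by (simp add: fun_eq_iff gram_sum)
    then show "x + y \<in> range (\<lambda>t s. gram s t)" by blast
  next
    fix c x assume "x \<in> range (\<lambda>t s. gram s t)"
    then obtain n f where "x = (\<lambda>s. gram s (n, f))" by auto
    then have "c *\<^sub>C x = (\<lambda>s. gram s (n, c *\<^sub>C f))"
      by (simp add: fun_eq_iff gram_scaleC scaleC_fun_def scaleC_complex_def)
    then show "c *\<^sub>C x \<in> range (\<lambda>t s. gram s t)" by blast
  qed
  show "gram t s = cnj (gram s t)" for s t by (rule gram_hermitian)
  show "gram s s \<in> \<real>\<^sub>\<ge>\<^sub>0" for s by (cases s) (simp add: gram_diag mu_nonneg)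
qed

text \<open>
  The actions of \<open>U\<^sup>-\<^sup>1\<close>, \<open>U\<close> and \<open>\<pi>(g)\<close> on the indices of the vectors \<open>U\<^sup>-\<^sup>n \<pi>(f) \<phi>\<close>. On an element
  \<open>\<xi>\<close> of the reproducing kernel space an operator acts by composing \<open>\<xi>\<close> with the action of its
  adjoint.
\<close>

definition lower :: "nat \<times> 'a \<Rightarrow> nat \<times> 'a" where "lower = (\<lambda>(n, f). (Suc n, f))"
definition raise :: "nat \<times> 'a \<Rightarrow> nat \<times> 'a" where "raise = (\<lambda>(n, f). (n, V f))"
definition act :: "'a \<Rightarrow> nat \<times> 'a \<Rightarrow> nat \<times> 'a" where "act g = (\<lambda>(n, f). (n, (\<alpha> ^^ n) g * f))"

lemma gram_lower: "gram (lower s) t = gram s (raise t)"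
  by (simp add: gram_def lower_def raise_def case_prod_beta funpow_swap1)

text \<open>With s = (m, f) and t = (n, h), both sides are \<mu> at
  \<open>star (V^n f) * \<alpha>^(m+n)(g) * V^m h\<close>: the powers of \<alpha> from
  \<open>act\<close> and those produced by moving \<open>V\<close> past a factor add up to the same
  exponent.\<close>

lemma gram_act: "gram (act (star g) s) t = gram s (act g t)"
proof -
  obtain m f n h where s: "s = (m, f)" and t: "t = (n, h)" by fastforce
  have comp: "(\<alpha> ^^ n) ((\<alpha> ^^ m) x) = (\<alpha> ^^ (m + n)) x"
    "(\<alpha> ^^ m) ((\<alpha> ^^ n) x) = (\<alpha> ^^ (m + n)) x" for x
    using fun_cong[OF funpow_add[of n m \<alpha>], of x] fun_cong[OF funpow_add[of m n \<alpha>], of x]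
    by (simp_all only: comp_apply add.commute[of n m])
  have "star ((V ^^ n) ((\<alpha> ^^ m) (star g) * f)) = star ((V ^^ n) f) * (\<alpha> ^^ (m + n)) g"
    unfolding Vn_mult star_mult comp n_star star_star ..
  moreover have "(V ^^ m) ((\<alpha> ^^ n) g * h) = (\<alpha> ^^ (m + n)) g * (V ^^ m) h"
    unfolding Vn_mult comp ..
  ultimately show ?thesis by (simp add: gram_def act_def s t mult.assoc)
qed

lemma lower_map: "kernel_map gram lower raise 1"
proof
  show "gram (lower s) t = gram s (raise t)" for s t by (rule gram_lower)
  show "Re (gram (raise t) (raise t)) \<le> 1 * Re (gram t t)" for t
    by (cases t) (simp add: raise_def gram_diag V_isometric)
qed

lemma raise_map: "kernel_map gram raise lower 1"
proof
  show "gram (raise s) t = gram s (lower t)" for s t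
    by (metis gram_hermitian gram_lower)
  show "Re (gram (lower t) (lower t)) \<le> 1 * Re (gram t t)" for t
    by (cases t) (simp add: lower_def gram_diag)
qed

text \<open>At level n the bound is \<open>hom_bound\<close> for the n-th power of \<alpha>. Its
  constant does not depend on n, so it serves for the whole index set.\<close>

lemma act_map: "kernel_map gram (act (star g)) (act g) ((norm g + 1)\<^sup>2)"
proof
  show "gram (act (star g) s) t = gram s (act g t)" for s t by (rule gram_act)
  show "Re (gram (act g t) (act g t)) \<le> (norm g + 1)\<^sup>2 * Re (gram t t)" for t
    by (cases t) (simp add: act_def gram_diag hom_bound[OF star_endo_n])
qed

lemma act_map': "kernel_map gram (act g) (act (star g)) ((norm (star g) + 1)\<^sup>2)"
  using act_map[of "star g"] by (simp add: star_star)

text \<open>On indices \<open>lower\<close> and \<open>raise\<close> compose to the map from (n, f)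
  to (Suc n, V f), not to the identity. Sections, and with them all functions of the space, identify
  the two indices; this makes the shift invertible.\<close>

lemma k_raise_lower: "k (Suc n, V f) = k (n, f)"
  using gram_raise[of _ n 1 f] by (simp add: k_def)

lemma apply_raise_lower: "\<xi> \<in> hcarrier rkhs \<Longrightarrow> \<xi> (Suc n, V f) = \<xi> (n, f)"
  using reproducing[of \<xi> "(Suc n, V f)"] reproducing[of \<xi> "(n, f)"] by (simp add: k_raise_lower)

lemma apply_add: "\<xi> \<in> hcarrier rkhs \<Longrightarrow> \<xi> (n, f + g) = \<xi> (n, f) + \<xi> (n, g)"
proof -
  assume \<xi>: "\<xi> \<in> hcarrier rkhs"
  have "k (n, f + g) = k (n, f) + k (n, g)" by (simp add: k_def fun_eq_iff gram_add)
  then show ?thesis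
    using reproducing[OF \<xi>, of "(n, f + g)"] reproducing[OF \<xi>, of "(n, f)"] reproducing[OF \<xi>, of "(n, g)"]
      R.inner_add_left[OF k_mem k_mem \<xi>] by simp
qed

text \<open>The value at (n, f) is the inner product with \<open>k (n, f)\<close> on the left, hence
  antilinear in \<open>f\<close>. Together with the star in \<open>rep\<close> this makes
  \<open>rep\<close> linear.\<close>

lemma apply_scaleC: "\<xi> \<in> hcarrier rkhs \<Longrightarrow> \<xi> (n, c *\<^sub>C f) = cnj c * \<xi> (n, f)"
proof -
  assume \<xi>: "\<xi> \<in> hcarrier rkhs"
  have "k (n, c *\<^sub>C f) = c *\<^sub>C k (n, f)"
    by (simp add: k_def fun_eq_iff gram_scaleC scaleC_fun_def scaleC_complex_def)
  then show ?thesis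
    using reproducing[OF \<xi>, of "(n, c *\<^sub>C f)"] reproducing[OF \<xi>, of "(n, f)"]
      R.inner_scaleC_left[OF k_mem \<xi>] by simp
qed

section \<open>The unitary and the representation on the kernel space\<close>

definition shift :: "(nat \<times> 'a \<Rightarrow> complex) \<Rightarrow> nat \<times> 'a \<Rightarrow> complex" where
  "shift \<xi> = \<xi> \<circ> lower"

definition rep :: "'a \<Rightarrow> (nat \<times> 'a \<Rightarrow> complex) \<Rightarrow> nat \<times> 'a \<Rightarrow> complex" where
  "rep g \<xi> = \<xi> \<circ> act (star g)"

lemma shift_mem: "\<xi> \<in> hcarrier rkhs \<Longrightarrow> shift \<xi> \<in> hcarrier rkhs"
  unfolding shift_def by (rule kernel_map.comp_mem[OF lower_map])

lemma unshift_mem: "\<xi> \<in> hcarrier rkhs \<Longrightarrow> \<xi> \<circ> raise \<in> hcarrier rkhs"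
  by (rule kernel_map.comp_mem[OF raise_map])

lemma rep_mem: "\<xi> \<in> hcarrier rkhs \<Longrightarrow> rep g \<xi> \<in> hcarrier rkhs"
  unfolding rep_def by (rule kernel_map.comp_mem[OF act_map])

lemma unshift_shift: "\<xi> \<in> hcarrier rkhs \<Longrightarrow> shift \<xi> \<circ> raise = \<xi>"
  by (auto simp: shift_def lower_def raise_def fun_eq_iff apply_raise_lower)

lemma shift_unshift: "\<xi> \<in> hcarrier rkhs \<Longrightarrow> shift (\<xi> \<circ> raise) = \<xi>"
  by (auto simp: shift_def lower_def raise_def fun_eq_iff apply_raise_lower)

lemma shift_k: "shift (k (Suc n, f)) = k (n, f)"
  using kernel_map.section_comp[OF lower_map, of "(Suc n, f)"]
  by (simp add: shift_def raise_def k_raise_lower)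

lemma rep_k: "rep g (k (n, f)) = k (n, (\<alpha> ^^ n) g * f)"
  using kernel_map.section_comp[OF act_map, of "(n, f)" g] by (simp add: rep_def act_def)

lemma adjoint_shift:
  assumes "\<xi> \<in> hcarrier rkhs" shows "hadjoint rkhs rkhs shift \<xi> = \<xi> \<circ> raise"
proof (rule R.hadjoint_eqI)
  show "hinner rkhs (shift x) \<xi> = hinner rkhs x (\<xi> \<circ> raise)" if "x \<in> hcarrier rkhs" for x
    unfolding shift_def by (rule inner_comp[OF lower_map raise_map that assms])
qed (rule unshift_mem[OF assms])

lemma adjoint_rep:
  assumes "\<xi> \<in> hcarrier rkhs" shows "hadjoint rkhs rkhs (rep g) \<xi> = rep (star g) \<xi>"
proof (rule R.hadjoint_eqI)
  show "hinner rkhs (rep g x) \<xi> = hinner rkhs x (rep (star g) \<xi>)" if "x \<in> hcarrier rkhs" for x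
    unfolding rep_def star_star by (rule inner_comp[OF act_map act_map' that assms])
qed (rule rep_mem[OF assms])

lemma unitary_shift: "unitary_op rkhs rkhs shift"
  unfolding unitary_op_def
proof (intro conjI ballI)
  show "bounded_op rkhs rkhs shift"
    using kernel_map.bounded_comp[OF lower_map] by (simp add: shift_def[abs_def])
qed (simp_all add: adjoint_shift shift_mem unshift_shift shift_unshift)

lemma representation_rep: "representation rkhs rep"
  unfolding representation_def
proof (intro conjI allI ballI)
  show "bounded_op rkhs rkhs (rep f)" for f
    using kernel_map.bounded_comp[OF act_map] by (simp add: rep_def[abs_def])
  fix f g :: 'a and \<xi> assume \<xi>: "\<xi> \<in> hcarrier rkhs"
  show "rep (f + g) \<xi> = rep f \<xi> + rep g \<xi>"
    by (auto simp: rep_def act_def fun_eq_iff star_add n_add distrib_right apply_add[OF \<xi>])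
  show "rep (c *\<^sub>C f) \<xi> = c *\<^sub>C rep f \<xi>" for c
    by (auto simp: rep_def act_def fun_eq_iff star_scaleC n_scaleC mult_scaleC_left
        apply_scaleC[OF \<xi>] scaleC_fun_def scaleC_complex_def)
  \<comment> \<open>Composition on the right reverses the order of factors, and so does the
    star.\<close>
  show "rep (f * g) \<xi> = rep f (rep g \<xi>)"
    by (auto simp: rep_def act_def fun_eq_iff star_mult n_mult mult.assoc)
  show "rep (star f) \<xi> = hadjoint rkhs rkhs (rep f) \<xi>"
    by (simp add: adjoint_rep[OF \<xi>])
qed

lemma unshift_k: "inv_into (hcarrier rkhs) shift (k (n, f)) = k (Suc n, f)"
proof (rule inv_into_f_eq)
  show "inj_on shift (hcarrier rkhs)" by (rule inj_on_inverseI) (rule unshift_shift)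
qed (rule k_mem shift_k)+

lemma unshift_pow_k: "(inv_into (hcarrier rkhs) shift ^^ n) (k (0, f)) = k (n, f)"
  by (induction n) (simp_all add: unshift_k)

lemma existence: "covariant_quadruple \<alpha> \<mu> m\<^sub>0 rkhs shift rep (k (0, 1))"
  unfolding covariant_quadruple_def
proof (intro conjI allI ballI)
  show "hilbert_space rkhs" unfolding hilbert_iff by unfold_locales
  show "representation rkhs rep" by (rule representation_rep)
  show "unitary_op rkhs rkhs shift" by (rule unitary_shift)
  show "k (0, 1) \<in> hcarrier rkhs" by (rule k_mem)
  show "shift (rep f (hadjoint rkhs rkhs shift \<xi>)) = rep (\<alpha> f) \<xi>" if \<xi>: "\<xi> \<in> hcarrier rkhs" for f \<xi>
  proof -
    have "shift (rep f (\<xi> \<circ> raise)) (n, h) = rep (\<alpha> f) \<xi> (n, h)" for n h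
    proof -
      have "shift (rep f (\<xi> \<circ> raise)) (n, h) = \<xi> (Suc n, V ((\<alpha> ^^ Suc n) (star f) * h))"
        by (simp add: shift_def rep_def raise_def lower_def act_def)
      also have "\<dots> = \<xi> (n, (\<alpha> ^^ Suc n) (star f) * h)"
        by (rule apply_raise_lower[OF \<xi>])
      also have "\<dots> = rep (\<alpha> f) \<xi> (n, h)"
        by (simp add: rep_def act_def star[symmetric] funpow_swap1)
      finally show ?thesis .
    qed
    then show ?thesis by (auto simp: adjoint_shift[OF \<xi>] fun_eq_iff)
  qed
  show "hinner rkhs (k (0, 1)) (rep f (k (0, 1))) = \<mu> f" for f
    by (simp add: rep_k reproducing k_mem) (simp add: k_def gram_def)
  show "shift (k (0, 1)) = rep (\<alpha> 1 * m\<^sub>0) (k (0, 1))"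
    using kernel_map.section_comp[OF lower_map, of "(0, 1)"]
    by (simp add: shift_def rep_k raise_def V_def)
  \<comment> \<open>The vectors in question are exactly the kernel sections, which are already a
    subspace, so taking the span adds nothing.\<close>
  have set_eq: "{(inv_into (hcarrier rkhs) shift ^^ n) (rep f (k (0, 1))) | n f. True} = range k"
    by (auto simp: rep_k unshift_pow_k)
  have span_eq: "complex_vector.span (range k) = range k"
    using D.subspace by (simp add: complex_vector.span_eq_iff)
  have "range k \<subseteq> hcarrier rkhs" using k_mem by blast
  then show "htopology rkhs closure_of complex_vector.span
      {(inv_into (hcarrier rkhs) shift ^^ n) (rep f (k (0, 1))) | n f. True} = hcarrier rkhs"
    unfolding set_eq span_eq using dense_sections R.closure_of_iff by blast
qed

end

section \<open>The total family of an arbitrary quadruple\<close>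

locale quadruple = covariant_data \<alpha> \<mu> m\<^sub>0
  for \<alpha> :: "'a::unital_cstar_algebra \<Rightarrow> 'a" and \<mu> m\<^sub>0 +
  fixes X :: "'h::complex_vector hspace" and U \<pi> \<phi>
  assumes quadruple: "covariant_quadruple \<alpha> \<mu> m\<^sub>0 X U \<pi> \<phi>"

sublocale quadruple \<subseteq> X: hilbert X
  using quadruple by (simp add: covariant_quadruple_def hilbert_iff)

context quadruple
begin

lemma U_bounded: "bounded_operator X X U"
  using quadruple X.hilbert_axioms X.inner_space_axioms
  by (simp add: covariant_quadruple_def unitary_op_def bounded_operator_def bounded_operator_axioms_def)

lemma pi_bounded: "bounded_operator X X (\<pi> f)"
  using quadruple X.hilbert_axioms X.inner_space_axioms
  by (simp add: covariant_quadruple_def representation_def bounded_operator_def bounded_operator_axioms_def)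

abbreviation "H \<equiv> hcarrier X"

lemma U_mem: "x \<in> H \<Longrightarrow> U x \<in> H"
  and U_add: "x \<in> H \<Longrightarrow> y \<in> H \<Longrightarrow> U (x + y) = U x + U y"
  and U_scaleC: "x \<in> H \<Longrightarrow> U (c *\<^sub>C x) = c *\<^sub>C U x"
  using bounded_operator.bounded[OF U_bounded] unfolding bounded_op_def by blast+

lemma pi_mem: "x \<in> H \<Longrightarrow> \<pi> f x \<in> H"
  using bounded_operator.bounded[OF pi_bounded[of f]] unfolding bounded_op_def by blast

lemma pi_add: "x \<in> H \<Longrightarrow> \<pi> (f + g) x = \<pi> f x + \<pi> g x"
  and pi_scaleC: "x \<in> H \<Longrightarrow> \<pi> (c *\<^sub>C f) x = c *\<^sub>C \<pi> f x"
  and pi_mult: "x \<in> H \<Longrightarrow> \<pi> (f * g) x = \<pi> f (\<pi> g x)"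
  and pi_star: "x \<in> H \<Longrightarrow> \<pi> (star f) x = hadjoint X X (\<pi> f) x"
  using quadruple unfolding covariant_quadruple_def representation_def by blast+

lemma adjoint_U: "x \<in> H \<Longrightarrow> hadjoint X X U (U x) = x"
  and U_adjoint: "x \<in> H \<Longrightarrow> U (hadjoint X X U x) = x"
  using quadruple unfolding covariant_quadruple_def unitary_op_def by blast+

lemma phi_mem: "\<phi> \<in> H"
  and pi_covariant: "x \<in> H \<Longrightarrow> U (\<pi> f (hadjoint X X U x)) = \<pi> (\<alpha> f) x"
  and pi_state: "hinner X \<phi> (\<pi> f \<phi>) = \<mu> f"
  and U_phi: "U \<phi> = \<pi> (\<alpha> 1 * m\<^sub>0) \<phi>"
  using quadruple unfolding covariant_quadruple_def by blast+

lemma inner_pi: "x \<in> H \<Longrightarrow> y \<in> H \<Longrightarrow> hinner X x (\<pi> f y) = hinner X (\<pi> (star f) x) y"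
  using bounded_operator.adjoint_inner[OF pi_bounded, of y x "star f"] pi_star[of y "star f"]
  by (simp add: star_star)

lemma inner_U: "x \<in> H \<Longrightarrow> y \<in> H \<Longrightarrow> hinner X (U x) (U y) = hinner X x y"
  using bounded_operator.adjoint_inner[OF U_bounded, of "U y" x] by (simp add: adjoint_U U_mem)

lemma U_inj: "inj_on U H"
  by (rule inj_on_inverseI) (rule adjoint_U)

lemma U_image: "U ` H = H"
proof
  show "H \<subseteq> U ` H"
    using U_adjoint bounded_operator.adjoint_mem[OF U_bounded] by (metis imageI subsetI)
qed (use U_mem in auto)

definition Uinv :: "'h \<Rightarrow> 'h" where "Uinv = inv_into H U"

lemma Uinv_mem: "x \<in> H \<Longrightarrow> Uinv x \<in> H"
  using inv_into_into[of x U H] by (simp add: U_image Uinv_def)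

lemma U_Uinv: "x \<in> H \<Longrightarrow> U (Uinv x) = x"
  using f_inv_into_f[of x U H] by (simp add: U_image Uinv_def)

lemma Uinv_U: "x \<in> H \<Longrightarrow> Uinv (U x) = x"
  by (simp add: Uinv_def inv_into_f_f U_inj)

lemma UinvI: "x \<in> H \<Longrightarrow> U x = y \<Longrightarrow> Uinv y = x"
  using Uinv_U by blast

lemma Uinv_add: "x \<in> H \<Longrightarrow> y \<in> H \<Longrightarrow> Uinv (x + y) = Uinv x + Uinv y"
  by (intro UinvI X.mem Uinv_mem) (simp_all add: U_add Uinv_mem U_Uinv)

lemma Uinv_scaleC: "x \<in> H \<Longrightarrow> Uinv (c *\<^sub>C x) = c *\<^sub>C Uinv x"
  by (intro UinvI X.mem Uinv_mem) (simp_all add: U_scaleC Uinv_mem U_Uinv)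

lemma inner_U_right: "x \<in> H \<Longrightarrow> y \<in> H \<Longrightarrow> hinner X x (U y) = hinner X (Uinv x) y"
  using inner_U[of "Uinv x" y] by (simp add: U_Uinv Uinv_mem)

lemma U_pi: "x \<in> H \<Longrightarrow> U (\<pi> f x) = \<pi> (\<alpha> f) (U x)"
  using pi_covariant[of "U x" f] by (simp add: U_mem adjoint_U)

lemma pi_Uinv: "x \<in> H \<Longrightarrow> \<pi> f (Uinv x) = Uinv (\<pi> (\<alpha> f) x)"
  by (rule UinvI[symmetric]) (simp_all add: U_pi U_Uinv Uinv_mem pi_mem)

text \<open>Covariance moves \<open>U\<close> onto \<phi>, and
  \<open>\<alpha> f * \<alpha> 1 = \<alpha> f\<close> absorbs the projection in the condition on
  \<open>U \<phi>\<close>.\<close>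

lemma U_pi_phi: "U (\<pi> f \<phi>) = \<pi> (V f) \<phi>"
proof -
  have "U (\<pi> f \<phi>) = \<pi> (\<alpha> f * (\<alpha> 1 * m\<^sub>0)) \<phi>"
    by (simp add: U_pi phi_mem U_phi pi_mult)
  also have "\<alpha> f * (\<alpha> 1 * m\<^sub>0) = V f"
    using mult[of f 1] by (simp add: V_def mult.assoc[symmetric])
  finally show ?thesis .
qed

definition vec :: "nat \<times> 'a \<Rightarrow> 'h" where
  "vec = (\<lambda>(n, f). (Uinv ^^ n) (\<pi> f \<phi>))"

lemma vec_Suc: "vec (Suc n, f) = Uinv (vec (n, f))"
  by (simp add: vec_def)

lemma vec_mem: "vec s \<in> H"
proof (cases s)
  case (Pair n f)
  have "(Uinv ^^ n) (\<pi> f \<phi>) \<in> H" by (induction n) (simp_all add: Uinv_mem pi_mem phi_mem)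
  then show ?thesis by (simp add: vec_def Pair)
qed

lemma U_vec: "U (vec (n, f)) = vec (n, V f)"
proof (cases n)
  case 0
  then show ?thesis by (simp add: vec_def U_pi_phi)
next
  case (Suc m)
  \<comment> \<open>Level 0 is \<open>U_pi_phi\<close> inverted; each further level applies
    \<open>Uinv\<close> to both sides.\<close>
  have "Uinv (vec (m, V f)) = vec (m, f)" for m
  proof (induction m)
    case 0
    show ?case by (rule UinvI[OF vec_mem]) (simp add: vec_def U_pi_phi)
  qed (simp add: vec_Suc)
  then show ?thesis by (simp add: Suc vec_Suc U_Uinv vec_mem)
qed

lemma vec_raise_lower: "vec (Suc n, V f) = vec (n, f)"
  using Uinv_U[OF vec_mem, of "(n, f)"] by (simp add: vec_Suc U_vec)

lemma vec_raise: "vec (n + m, (V ^^ m) f) = vec (n, f)"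
  by (induction m) (simp_all add: vec_raise_lower)

text \<open>By \<open>pi_Uinv\<close>, each \<open>Uinv\<close> that \<open>\<pi> g\<close> passes
  costs one application of \<alpha>.\<close>

lemma pi_vec: "\<pi> g (vec (n, f)) = vec (n, (\<alpha> ^^ n) g * f)"
proof (induction n arbitrary: g)
  case 0
  show ?case by (simp add: vec_def pi_mult phi_mem)
next
  case (Suc n)
  show ?case
    by (simp add: vec_Suc pi_Uinv vec_mem Suc.IH funpow_swap1)
qed

lemma gram_vec: "hinner X (vec s) (vec t) = gram s t"
proof -
  obtain m f n g where s: "s = (m, f)" and t: "t = (n, g)" by fastforce
  have lower_eq: "hinner X (vec (j + m, f)) (vec (j + n, g)) = hinner X (vec (m, f)) (vec (n, g))"
    for j m n f g
  proof (induction j)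
    case (Suc j)
    have "hinner X (vec (Suc (j + m), f)) (vec (Suc (j + n), g)) =
        hinner X (vec (j + m, f)) (vec (j + n, g))"
      using inner_U[of "vec (Suc (j + m), f)" "vec (Suc (j + n), g)"]
      by (simp add: vec_mem) (simp add: vec_Suc U_Uinv vec_mem)
    then show ?case using Suc by simp
  qed simp
  \<comment> \<open>Both vectors are first rewritten at the common level \<open>m + n\<close>; then
    all powers of \<open>Uinv\<close> cancel by unitarity, leaving an inner product at level 0 that
    the state evaluates.\<close>
  have "hinner X (vec s) (vec t) = hinner X (vec (m + n, (V ^^ n) f)) (vec (n + m, (V ^^ m) g))"
    by (simp add: vec_raise s t)
  also have "\<dots> = hinner X (vec (0, (V ^^ n) f)) (vec (0, (V ^^ m) g))"
    using lower_eq[of "m + n" 0 "(V ^^ n) f" 0 "(V ^^ m) g"] by (simp add: add.commute)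
  also have "\<dots> = hinner X \<phi> (\<pi> (star ((V ^^ n) f)) (\<pi> ((V ^^ m) g) \<phi>))"
    by (simp add: vec_def inner_pi pi_mem phi_mem star_star)
  also have "\<dots> = gram s t"
    by (simp add: s t gram_def pi_state phi_mem flip: pi_mult)
  finally show ?thesis .
qed

text \<open>Representations may be degenerate, so \<phi> is placed in the family through the
  condition on \<open>U \<phi>\<close>, at level 1, rather than as
  \<open>\<pi> 1 \<phi>\<close>.\<close>

lemma vec_phi: "vec (1, \<alpha> 1 * m\<^sub>0) = \<phi>"
  using Uinv_U[OF phi_mem] by (simp add: vec_def U_phi)

lemma vec_add: "vec (n, f + g) = vec (n, f) + vec (n, g)"
proof (induction n)
  case 0
  show ?case by (simp add: vec_def pi_add phi_mem)
qed (simp add: vec_Suc Uinv_add vec_mem)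

lemma vec_scaleC: "vec (n, c *\<^sub>C f) = c *\<^sub>C vec (n, f)"
proof (induction n)
  case 0
  show ?case by (simp add: vec_def pi_scaleC phi_mem)
qed (simp add: vec_Suc Uinv_scaleC vec_mem)

text \<open>Raising to a common level shows that the family is closed under sums, so it equals its
  span and is itself dense, as \<open>gram_pair\<close> demands.\<close>

lemma dense_vec: "X.dense (range vec)"
proof -
  have "complex_vector.subspace (range vec)"
  proof (rule complex_vector.subspaceI)
    have "vec (0, 0 *\<^sub>C 0) = 0" unfolding vec_scaleC by simp
    then show "0 \<in> range vec" by (metis rangeI)
  next
    fix x y assume "x \<in> range vec" "y \<in> range vec"
    then obtain n f m g where "x = vec (n, f)" "y = vec (m, g)" by auto
    then have "x + y = vec (n + m, (V ^^ m) f + (V ^^ n) g)"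
      using vec_raise[of n m f] vec_raise[of m n g] by (simp add: vec_add add.commute)
    then show "x + y \<in> range vec" by blast
  next
    fix c x assume "x \<in> range vec"
    then obtain n f where "x = vec (n, f)" by auto
    then have "c *\<^sub>C x = vec (n, c *\<^sub>C f)" by (simp add: vec_scaleC)
    then show "c *\<^sub>C x \<in> range vec" by blast
  qed
  then have span_eq: "complex_vector.span (range vec) = range vec"
    by (simp add: complex_vector.span_eq_iff)
  have set_eq: "{(inv_into H U ^^ n) (\<pi> f \<phi>) | n f. True} = range vec"
    by (force simp: vec_def Uinv_def)
  have "htopology X closure_of range vec = H"
    using quadruple unfolding covariant_quadruple_def set_eq span_eq by blast
  moreover have "range vec \<subseteq> H" using vec_mem by blast
  ultimately show ?thesis using X.closure_of_iff by blast
qed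

end

section \<open>Uniqueness up to a unitary intertwiner\<close>

locale two_quadruples =
  A: quadruple \<alpha> \<mu> m\<^sub>0 X U \<pi> \<phi> + B: quadruple \<alpha> \<mu> m\<^sub>0 X' U' \<pi>' \<phi>'
  for \<alpha> :: "'a::unital_cstar_algebra \<Rightarrow> 'a" and \<mu> m\<^sub>0
    and X :: "'h::complex_vector hspace" and U \<pi> \<phi>
    and X' :: "'k::complex_vector hspace" and U' \<pi>' \<phi>'
begin

sublocale gram_pair X X' A.vec B.vec
  by unfold_locales (auto simp: A.dense_vec B.dense_vec A.gram_vec B.gram_vec)

text \<open>In an inner product with \<open>vec (n, f)\<close>, \<open>U\<close> moves across as
  \<open>Uinv\<close>, which only raises the level to \<open>Suc n\<close>. The new vector is again
  in the family, where \<open>iso\<close> is controlled by \<open>inner_iso\<close>.\<close>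

lemma iso_U:
  assumes x: "x \<in> hcarrier X" shows "iso (U x) = U' (iso x)"
proof (rule iso_unique)
  fix s :: "nat \<times> 'a"
  obtain n f where s: "s = (n, f)" by fastforce
  show "hinner X' (B.vec s) (U' (iso x)) = hinner X (A.vec s) (U x)"
    using inner_iso[OF x, of "(Suc n, f)"]
    by (simp add: s A.inner_U_right B.inner_U_right A.vec_mem B.vec_mem x iso_mem A.vec_Suc B.vec_Suc)
qed (intro B.U_mem iso_mem x)

text \<open>Moved across the inner product, \<open>\<pi> f\<close> becomes
  \<open>\<pi> (star f)\<close>, which by \<open>pi_vec\<close> permits the same index change in
  both families.\<close>

lemma iso_pi:
  assumes x: "x \<in> hcarrier X" shows "iso (\<pi> f x) = \<pi>' f (iso x)"
proof (rule iso_unique)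
  fix s :: "nat \<times> 'a"
  obtain n g where s: "s = (n, g)" by fastforce
  show "hinner X' (B.vec s) (\<pi>' f (iso x)) = hinner X (A.vec s) (\<pi> f x)"
    by (simp add: s A.inner_pi B.inner_pi A.vec_mem B.vec_mem x iso_mem A.pi_vec B.pi_vec inner_iso)
qed (intro B.pi_mem iso_mem x)

lemma iso_phi: "iso \<phi> = \<phi>'"
proof (rule iso_unique)
  show "hinner X' (B.vec s) \<phi>' = hinner X (A.vec s) \<phi>" for s
    using A.gram_vec[of s "(1, \<alpha> 1 * m\<^sub>0)", unfolded A.vec_phi]
      B.gram_vec[of s "(1, \<alpha> 1 * m\<^sub>0)", unfolded B.vec_phi] by (rule trans[OF _ sym, rotated])
qed (rule B.phi_mem)

end

theorem theorem4p1p4: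
  fixes \<alpha> :: "'a::unital_cstar_algebra \<Rightarrow> 'a"
    and \<mu> :: "'a \<Rightarrow> complex"
    and m\<^sub>0 :: 'a
  assumes "star_hom \<alpha>"
    and "cstar_state \<mu>"
    and "\<And>f. \<mu> (star m\<^sub>0 * \<alpha> f * m\<^sub>0) = \<mu> f"
  shows
    "(\<exists>(X :: (nat \<times> 'a \<Rightarrow> complex) hspace) U \<pi> \<phi>. covariant_quadruple \<alpha> \<mu> m\<^sub>0 X U \<pi> \<phi>) \<and>
     (\<forall>(X :: 'h::complex_vector hspace) U \<pi> \<phi> (X' :: 'k::complex_vector hspace) U' \<pi>' \<phi>'.
        covariant_quadruple \<alpha> \<mu> m\<^sub>0 X U \<pi> \<phi> \<longrightarrow>
        covariant_quadruple \<alpha> \<mu> m\<^sub>0 X' U' \<pi>' \<phi>' \<longrightarrow>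
        (\<exists>W. unitary_op X X' W \<and>
             (\<forall>x\<in>hcarrier X. W (U x) = U' (W x)) \<and>
             (\<forall>f. \<forall>x\<in>hcarrier X. W (\<pi> f x) = \<pi>' f (W x)) \<and>
             W \<phi> = \<phi>'))"
proof -
  interpret covariant_data \<alpha> \<mu> m\<^sub>0 by unfold_locales (fact assms)+
  show ?thesis
  proof (intro conjI allI impI)
    show "\<exists>(X :: (nat \<times> 'a \<Rightarrow> complex) hspace) U \<pi> \<phi>. covariant_quadruple \<alpha> \<mu> m\<^sub>0 X U \<pi> \<phi>"
      using existence by blast
  next
    fix X :: "'h hspace" and U \<pi> \<phi> and X' :: "'k hspace" and U' \<pi>' \<phi>'
    assume "covariant_quadruple \<alpha> \<mu> m\<^sub>0 X U \<pi> \<phi>" "covariant_quadruple \<alpha> \<mu> m\<^sub>0 X' U' \<pi>' \<phi>'"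
    then interpret two_quadruples \<alpha> \<mu> m\<^sub>0 X U \<pi> \<phi> X' U' \<pi>' \<phi>' by unfold_locales
    show "\<exists>W. unitary_op X X' W \<and>
             (\<forall>x\<in>hcarrier X. W (U x) = U' (W x)) \<and>
             (\<forall>f. \<forall>x\<in>hcarrier X. W (\<pi> f x) = \<pi>' f (W x)) \<and>
             W \<phi> = \<phi>'"
      by (rule exI[of _ iso]) (simp add: unitary_iso iso_U iso_pi iso_phi)
  qed
qed

end
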